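(* Let $a<b$ be real numbers, $T=b-a$, $t\in(a,b)$ fixed, and $\sigma>0$. Let the function $u(z)$ be analytic and periodic with period $T$ in the infinite strip $D_\sigma=\{z\in\mathbb{C}:\ |\operatorname{Im}z|<\sigma\}$, let $$K(z)=\frac{\cos\frac{\pi(z-t)}{T}}{\sin^3\frac{\pi(z-t)}{T}},\qquad f(x)=K(x)\,u(x),$$ and let $I[f]$ be the Hadamard Finite Part of $\int_a^bf(x)\,dx$. Define $E^{(s)}_n[f]=\widehat{T}^{(s)}_n[f]-I[f]$, $s=0,1,2$, for positive integers $n$. Let $$F_1(z)=K(z)\left[u(z)-u(t)-\frac{T}{\pi}u'(t)\tan\frac{\pi(z-t)}{T}-\frac{T^2}{2\pi^2}u''(t)\sin^2\frac{\pi(z-t)}{T}\right].$$ Then $F_1$ is $T$-periodic and (after removal of removable singularities) analytic in $D_\sigma$, and with $$M(\tau)=\max_{x\in\mathbb{R}}|F_1(x+\mathrm{i}\tau)|+\max_{x\in\mathbb{R}}|F_1(x-\mathrm{i}\tau)|,\qquad \phi_n(\tau)=\frac{e^{-2n\pi\tau/T}}{1-e^{-2n\pi\tau/T}},$$ the following hold for all $\tau\in(0,\sigma)$: $$|E^{(0)}_n[f]|\le T\,M(\tau)\,\phi_n(\tau),$$ $$|E^{(1)}_n[f]|\le T\,M(\tau)\,[\phi_n(\tau)+2\phi_{2n}(\tau)],$$ $$|E^{(2)}_n[f]|\le T\,M(\tau)\,[2\phi_n(\tau)+5\phi_{2n}(\tau)+2\phi_{4n}(\tau)].$$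
   Context: Let $f$ be a $T$-periodic function which is $C^\infty$ on $\mathbb{R}\setminus\{t+kT:\ k\in\mathbb{Z}\}$ and such that $g(x)=(x-t)^3f(x)$ (extended to $x=t$) is $C^\infty$ on $[a,b]$. $I[f]$ denotes the Hadamard Finite Part of $\int_a^b f(x)\,dx$, that is, $$I[f]=\lim_{\epsilon\to0+}\left[\int_a^{t-\epsilon}f(x)\,dx+\int_{t+\epsilon}^bf(x)\,dx-\frac{2g'(t)}{\epsilon}\right].$$ With $h=T/n$, the quadrature formulas are $$\widehat{T}^{(0)}_n[f]=h\sum_{j=1}^{n-1}f(t+jh)-\frac{\pi^2}{3}g'(t)h^{-1}+\frac16 g'''(t)h,$$ $$\widehat{T}^{(1)}_n[f]=h\sum_{j=1}^{n}f(t+jh-h/2)-\pi^2g'(t)h^{-1},$$ $$\widehat{T}^{(2)}_n[f]=2h\sum_{j=1}^{n}f(t+jh-h/2)-\frac h2\sum_{j=1}^{2n}f(t+jh/2-h/4).$$ *)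

theory Defs
  imports "HOL-Complex_Analysis.Complex_Analysis"
begin

text \<open>The function \<open>g(x) = (x - t)\<^sup>3 f(x)\<close>, extended to \<open>x = t\<close> by continuity.\<close>

definition reg_part :: "real \<Rightarrow> (real \<Rightarrow> complex) \<Rightarrow> real \<Rightarrow> complex" where
  "reg_part t f x =
     (if x = t then Lim (at t) (\<lambda>y. of_real ((y - t) ^ 3) * f y)
      else of_real ((x - t) ^ 3) * f x)"

text \<open>The \<open>k\<close>-th derivative of a complex-valued function of a real variable.\<close>

definition rderiv :: "nat \<Rightarrow> (real \<Rightarrow> complex) \<Rightarrow> real \<Rightarrow> complex" where
  "rderiv k = ((\<lambda>g x. vector_derivative g (at x)) ^^ k)"

text \<open>
  Hadamard Finite Part of \<open>f\<close> over \<open>[a, b]\<close> for an integrand with a third-order singularity at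
  \<open>t\<close>. The integrals are Henstock--Kurzweil integrals over compact intervals that, for all
  sufficiently small \<open>\<epsilon> > 0\<close>, avoid the singularity.
\<close>

definition hfp :: "real \<Rightarrow> real \<Rightarrow> real \<Rightarrow> (real \<Rightarrow> complex) \<Rightarrow> complex" where
  "hfp a b t f =
     Lim (at_right 0) (\<lambda>\<epsilon>::real.
       integral {a..t - \<epsilon>} f + integral {t + \<epsilon>..b} f
         - 2 * rderiv 1 (reg_part t f) t / of_real \<epsilon>)"

definition quad0 :: "real \<Rightarrow> real \<Rightarrow> nat \<Rightarrow> (real \<Rightarrow> complex) \<Rightarrow> complex" where
  "quad0 T t n f = (let h = T / real n; g = reg_part t f in
     of_real h * (\<Sum>j = 1..n - 1. f (t + real j * h))
     - of_real (pi ^ 2 / 3) * rderiv 1 g t * of_real (inverse h)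
     + 1 / 6 * rderiv 3 g t * of_real h)"

definition quad1 :: "real \<Rightarrow> real \<Rightarrow> nat \<Rightarrow> (real \<Rightarrow> complex) \<Rightarrow> complex" where
  "quad1 T t n f = (let h = T / real n; g = reg_part t f in
     of_real h * (\<Sum>j = 1..n. f (t + real j * h - h / 2))
     - of_real (pi ^ 2) * rderiv 1 g t * of_real (inverse h))"

definition quad2 :: "real \<Rightarrow> real \<Rightarrow> nat \<Rightarrow> (real \<Rightarrow> complex) \<Rightarrow> complex" where
  "quad2 T t n f = (let h = T / real n in
     2 * of_real h * (\<Sum>j = 1..n. f (t + real j * h - h / 2))
     - of_real (h / 2) * (\<Sum>j = 1..2 * n. f (t + real j * h / 2 - h / 4)))"

definition err0 :: "real \<Rightarrow> real \<Rightarrow> real \<Rightarrow> nat \<Rightarrow> (real \<Rightarrow> complex) \<Rightarrow> complex" where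
  "err0 a b t n f = quad0 (b - a) t n f - hfp a b t f"

definition err1 :: "real \<Rightarrow> real \<Rightarrow> real \<Rightarrow> nat \<Rightarrow> (real \<Rightarrow> complex) \<Rightarrow> complex" where
  "err1 a b t n f = quad1 (b - a) t n f - hfp a b t f"

definition err2 :: "real \<Rightarrow> real \<Rightarrow> real \<Rightarrow> nat \<Rightarrow> (real \<Rightarrow> complex) \<Rightarrow> complex" where
  "err2 a b t n f = quad2 (b - a) t n f - hfp a b t f"

definition strip :: "real \<Rightarrow> complex set" where
  "strip \<sigma> = {z. \<bar>Im z\<bar> < \<sigma>}"

definition trig_kernel :: "real \<Rightarrow> real \<Rightarrow> complex \<Rightarrow> complex" where
  "trig_kernel T t z =
     cos (of_real pi * (z - of_real t) / of_real T)
       / sin (of_real pi * (z - of_real t) / of_real T) ^ 3"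

definition integrand :: "real \<Rightarrow> real \<Rightarrow> (complex \<Rightarrow> complex) \<Rightarrow> real \<Rightarrow> complex" where
  "integrand T t u x = trig_kernel T t (of_real x) * u (of_real x)"

text \<open>
  At the zeros of \<open>sin\<close> and \<open>cos\<close> (the points \<open>t + k T / 2\<close>), where the convention \<open>w / 0 = 0\<close>
  makes this formula meaningless, \<open>remove_sings\<close> below supplies the limit value.
\<close>

definition F1_formula :: "real \<Rightarrow> real \<Rightarrow> (complex \<Rightarrow> complex) \<Rightarrow> complex \<Rightarrow> complex" where
  "F1_formula T t u z = trig_kernel T t z *
     (u z - u (of_real t)
      - of_real (T / pi) * deriv u (of_real t)
          * tan (of_real pi * (z - of_real t) / of_real T)
      - of_real (T ^ 2 / (2 * pi ^ 2)) * (deriv ^^ 2) u (of_real t)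
          * sin (of_real pi * (z - of_real t) / of_real T) ^ 2)"

definition F1 :: "real \<Rightarrow> real \<Rightarrow> (complex \<Rightarrow> complex) \<Rightarrow> complex \<Rightarrow> complex" where
  "F1 T t u = remove_sings (F1_formula T t u)"

definition line_max :: "(complex \<Rightarrow> complex) \<Rightarrow> real \<Rightarrow> real" where
  "line_max F y = (GREATEST m. \<exists>x::real. m = norm (F (of_real x + \<i> * of_real y)))"

definition M_bound :: "real \<Rightarrow> real \<Rightarrow> (complex \<Rightarrow> complex) \<Rightarrow> real \<Rightarrow> real" where
  "M_bound T t u \<tau> = line_max (F1 T t u) \<tau> + line_max (F1 T t u) (- \<tau>)"

definition phi :: "real \<Rightarrow> nat \<Rightarrow> real \<Rightarrow> real" where
  "phi T n \<tau> = exp (- 2 * real n * pi * \<tau> / T) / (1 - exp (- 2 * real n * pi * \<tau> / T))"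

end

(* F1 is the integrand minus multiples of cos/sin^3, 1/sin^2 and cos/sin in pi (z - t)/T, chosen to cancel its
   singularities. The finite parts of these three functions vanish, and their sums over the quadrature nodes are 0,
   except that 1/sin^2 gives (n^2 - 1)/3 or n^2: this is exactly what the correction terms of the
   formulas remove. Hence I[f] is the period integral of F1, and the three formulas are the
   combinations T_n, 2 T_2n - T_n and 5 T_2n - 2 T_n - 2 T_4n of the trapezoidal rule T_n applied to F1. *)
theory Submission
  imports Defs "HOL-Real_Asymp.Real_Asymp"
begin

subsection \<open>The trapezoidal rule for periodic analytic functions\<close>

text \<open>The trapezoidal sum \<open>T_n\<close> of \<open>F1\<close> is \<open>h = T/n\<close>
  times the value at \<open>t\<close> of the sum of the translates of \<open>F1\<close> by multiples
  of \<open>h\<close>. This sum is \<open>h\<close>-periodic, so the error estimate has to be proved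
  for one node only. The two lines \<open>Im z = \<tau>\<close> and \<open>Im z = - \<tau>\<close>
  used there produce the two maxima in \<open>M_bound\<close>, and a geometric series in
  \<open>exp (- 2 * n * pi * \<tau> / T)\<close> produces \<open>phi\<close>. Period integrals are
  handled as increments of a primitive over one period; such an increment is the same at every
  height, which does the work of Cauchy's theorem on a rectangle. The obstacle is that
  \<open>F1\<close> is given by a formula that is singular at \<open>t\<close>, whereas
  \<open>T_n\<close> needs its exact value there. With y = pi (z - t)/T the kernel is y^(-3) + O(y),
  without a 1/y term. Hence g and (T/pi)^3 u have the same derivatives at \<open>t\<close> up to
  order 3, and one-sided limits along the real axis suffice to find the value of \<open>F1\<close>
  at \<open>t\<close>; the g''' term of the first formula is part of that value. The weights 1, 2
  and 2, 5, 2 in the bounds are the absolute values of the coefficients in the combinations of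
  trapezoidal rules.\<close>

lemma open_strip: "open (strip \<sigma>)"
  unfolding strip_def by (intro open_Collect_less continuous_intros)

lemma convex_strip: "convex (strip \<sigma>)"
proof -
  have "strip \<sigma> = {z. Im z < \<sigma>} \<inter> {z. Im z > - \<sigma>}"
    by (auto simp: strip_def)
  then show ?thesis
    by (simp add: convex_Int convex_halfspace_Im_lt convex_halfspace_Im_gt)
qed

lemma strip_add_of_real [simp]: "z + of_real x \<in> strip \<sigma> \<longleftrightarrow> z \<in> strip \<sigma>"
  by (simp add: strip_def)

lemma strip_of_real [simp]: "of_real x \<in> strip \<sigma> \<longleftrightarrow> \<sigma> > 0"
  by (simp add: strip_def)

lemma periodic_of_int:
  fixes F :: "complex \<Rightarrow> 'a"
  assumes per: "\<And>z. z \<in> strip \<sigma> \<Longrightarrow> F (z + of_real T) = F z" and z: "z \<in> strip \<sigma>"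
  shows "F (z + of_real (of_int k * T)) = F z"
proof -
  have nat: "F (w + of_real (of_nat m * T)) = F w" if "w \<in> strip \<sigma>" for w and m :: nat
  proof (induction m)
    case (Suc m)
    have "F (w + of_real (of_nat (Suc m) * T)) = F ((w + of_real (of_nat m * T)) + of_real T)"
      by (simp add: algebra_simps)
    also have "\<dots> = F w"
      using per[of "w + of_real (of_nat m * T)"] that Suc by (simp only: strip_add_of_real)
    finally show ?case .
  qed auto
  show ?thesis
  proof (cases k rule: int_cases2)
    case (nonneg m)
    then show ?thesis using nat[OF z, of m] by simp
  next
    case (nonpos m)
    have "F (z + of_real (of_int k * T) + of_real (of_nat m * T)) = F (z + of_real (of_int k * T))"
      using z by (intro nat) (simp only: strip_add_of_real)
    then show ?thesis by (simp add: nonpos)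
  qed
qed

text \<open>The difference \<open>P (z + T) - P z\<close> has derivative 0 on the convex strip and
  is therefore a constant \<open>C\<close>. This \<open>C\<close> is the integral of
  \<open>F\<close> over any horizontal segment of length \<open>T\<close> in the strip, whatever its
  height.\<close>

lemma periodic_primitive:
  assumes holo: "F holomorphic_on strip \<sigma>"
    and per: "\<And>z. z \<in> strip \<sigma> \<Longrightarrow> F (z + of_real T) = F z"
  obtains P C where "\<And>z. z \<in> strip \<sigma> \<Longrightarrow> (P has_field_derivative F z) (at z)"
    and "\<And>z. z \<in> strip \<sigma> \<Longrightarrow> P (z + of_real T) = P z + C"
proof -
  obtain P where "\<And>z. z \<in> strip \<sigma> \<Longrightarrow> (P has_field_derivative F z) (at z within strip \<sigma>)"
    using holomorphic_convex_primitive'[OF convex_strip open_strip holo] by blast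
  then have P: "(P has_field_derivative F z) (at z)" if "z \<in> strip \<sigma>" for z
    using that at_within_open[OF _ open_strip] by metis
  have "((\<lambda>z. P (z + of_real T) - P z) has_field_derivative 0) (at z within strip \<sigma>)"
    if z: "z \<in> strip \<sigma>" for z
  proof -
    have "((\<lambda>z. P (z + of_real T)) has_field_derivative F (z + of_real T)) (at z)"
      using P[of "z + of_real T"] z by (simp add: DERIV_shift)
    from DERIV_diff[OF this P[OF z]] show ?thesis
      using per[OF z] has_field_derivative_at_within by force
  qed
  then obtain C where "\<And>z. z \<in> strip \<sigma> \<Longrightarrow> P (z + of_real T) - P z = C"
    using has_field_derivative_zero_constant[OF convex_strip, of \<sigma> "\<lambda>z. P (z + of_real T) - P z"]
    by blast
  then show ?thesis
    using that[of P C] P by (simp add: diff_eq_eq add.commute)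
qed

lemma has_integral_horizontal_line:
  assumes "\<alpha> \<le> \<beta>"
    and "\<And>x. x \<in> {\<alpha>..\<beta>} \<Longrightarrow>
      (P has_field_derivative F (of_real x + \<i> * of_real y)) (at (of_real x + \<i> * of_real y))"
  shows "((\<lambda>x. F (of_real x + \<i> * of_real y)) has_integral
    P (of_real \<beta> + \<i> * of_real y) - P (of_real \<alpha> + \<i> * of_real y)) {\<alpha>..\<beta>}"
proof (rule fundamental_theorem_of_calculus[OF assms(1)])
  fix x assume x: "x \<in> {\<alpha>..\<beta>}"
  have "((\<lambda>x. of_real x + \<i> * of_real y) has_vector_derivative 1) (at x)"
    using has_vector_derivative_of_real[OF DERIV_ident]
    by (simp add: has_vector_derivative_add_const)
  from field_vector_diff_chain_at[OF this assms(2)[OF x]]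
  show "((\<lambda>x. P (of_real x + \<i> * of_real y)) has_vector_derivative
      F (of_real x + \<i> * of_real y)) (at x within {\<alpha>..\<beta>})"
    by (simp add: o_def has_vector_derivative_at_within)
qed

section \<open>Removable singularities: periodicity and analyticity after their removal\<close>

lemma remove_sings_periodic:
  assumes "\<And>z. z \<in> strip \<sigma> \<Longrightarrow> f (z + of_real T) = f z" "z \<in> strip \<sigma>"
  shows "remove_sings f (z + of_real T) = remove_sings f z"
proof -
  have "filtermap (\<lambda>w. w + of_real T) (at z) = at (z + of_real T)"
    using filtermap_at_shift[of "- of_real T" z] by simp
  then have "remove_sings f (z + of_real T) = remove_sings (f \<circ> (\<lambda>w. w + of_real T)) z"
    by (simp add: remove_sings_compose)
  also have "\<dots> = remove_sings f z"
  proof (rule remove_sings_cong)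
    have "eventually (\<lambda>w. w \<in> strip \<sigma>) (at z)"
      using assms(2) open_strip by (intro eventually_at_in_open') auto
    then show "\<forall>\<^sub>F w in at z. (f \<circ> (\<lambda>w. w + of_real T)) w = f w"
      by eventually_elim (simp add: assms(1))
  qed auto
  finally show ?thesis .
qed

text \<open>Meromorphy already excludes essential singularities, so without poles every isolated
  singularity has a finite limit. Analyticity is thus reduced to refuting poles, for which a limit
  along a single direction is enough.\<close>

lemma remove_sings_analytic_of_no_pole:
  assumes "f meromorphic_on A" "\<And>z. z \<in> A \<Longrightarrow> \<not> is_pole f z"
  shows "remove_sings f analytic_on A"
proof (subst analytic_on_analytic_at, safe)
  fix z assume z: "z \<in> A"
  then have f: "isolated_singularity_at f z" "not_essential f z"
    using assms(1) unfolding meromorphic_on_altdef by auto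
  then obtain c where "f \<midarrow>z\<rightarrow> c"
    using assms(2)[OF z] unfolding not_essential_def by auto
  with f(1) show "remove_sings f analytic_on {z}"
    by (rule remove_sings_analytic_at)
qed

text \<open>For \<open>Re w < 0\<close> this is the sum of the geometric series exp(w) + exp(2w) +
  ...; its value at the real point \<open>- 2 * n * pi * \<tau> / T\<close> is
  \<open>phi T n \<tau>\<close>.\<close>

definition geom_kernel :: "complex \<Rightarrow> complex" where
  "geom_kernel w = exp w / (1 - exp w)"

lemma norm_geom_kernel_le:
  assumes "Re w < 0"
  shows "norm (geom_kernel w) \<le> exp (Re w) / (1 - exp (Re w))"
proof -
  have "1 - exp (Re w) \<le> norm (1 - exp w)"
    using norm_triangle_ineq2[of 1 "exp w"] by simp
  then show ?thesis
    using assms unfolding geom_kernel_def by (auto simp: norm_divide intro!: divide_left_mono mult_pos_pos)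
qed

text \<open>A multiple of \<open>Ln (1 - exp w)\<close> is a primitive. Since \<open>exp w\<close>
  has modulus below 1 on the line, \<open>1 - exp w\<close> stays in the right half plane, where the
  principal logarithm is differentiable. The exponential has period \<open>h\<close>, so the
  primitive agrees at both ends. The sign \<open>s\<close> selects the line above or below the real
  axis and makes the real part of the argument negative on either one.\<close>

lemma geom_kernel_integral:
  fixes h t \<tau> s :: real
  assumes h: "h > 0" and \<tau>: "\<tau> > 0" and s: "s \<in> {1, -1}"
  shows "((\<lambda>x. geom_kernel (of_real s * (2 * of_real pi * \<i> *
      (of_real x + \<i> * of_real (s * \<tau>) - of_real t) / of_real h))) has_integral 0) {0..h}"
proof -
  define e where "e z = of_real s * (2 * of_real pi * \<i> * (z - of_real t) / of_real h)" for z
  define c where "c = - (of_real s * (2 * of_real pi * \<i> / of_real h))"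
  have c: "c \<noteq> 0" using h s by (auto simp: c_def)
  have Re: "Re (e (of_real x + \<i> * of_real (s * \<tau>))) < 0" for x
    using h \<tau> s by (auto simp: e_def divide_simps)
  have "((\<lambda>z. Ln (1 - exp (e z)) / c) has_field_derivative geom_kernel (e z)) (at z)"
    if "z = of_real x + \<i> * of_real (s * \<tau>)" for z x
  proof -
    have lt: "norm (exp (e z)) < 1" using Re[of x] that by simp
    then have "Re (exp (e z)) < 1" using complex_Re_le_cmod le_less_trans by blast
    then have np: "1 - exp (e z) \<notin> \<real>\<^sub>\<le>\<^sub>0" by (auto simp: complex_nonpos_Reals_iff)
    have ne: "1 - exp (e z) \<noteq> 0" using lt
      by (metis eq_iff_diff_eq_0 norm_one order_less_irrefl)
    have "(e has_field_derivative - c) (at z)"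
      unfolding e_def c_def using h by (auto intro!: derivative_eq_intros)
    from DERIV_diff[OF DERIV_const DERIV_fun_exp[OF this]]
    have "((\<lambda>z. 1 - exp (e z)) has_field_derivative c * exp (e z)) (at z)"
      by (simp add: mult.commute)
    from DERIV_cdivide[OF DERIV_chain2[OF has_field_derivative_Ln[OF np] this], of c]
    moreover have "inverse (1 - exp (e z)) * (c * exp (e z)) / c = geom_kernel (e z)"
      using c ne by (simp add: geom_kernel_def field_simps)
    ultimately show ?thesis by simp
  qed
  then have "((\<lambda>x. (\<lambda>z. geom_kernel (e z)) (of_real x + \<i> * of_real (s * \<tau>))) has_integral
      Ln (1 - exp (e (of_real h + \<i> * of_real (s * \<tau>)))) / c
      - Ln (1 - exp (e (of_real 0 + \<i> * of_real (s * \<tau>)))) / c) {0..h}"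
    using h by (intro has_integral_horizontal_line) auto
  moreover have "exp (e (of_real h + \<i> * of_real (s * \<tau>))) = exp (e (of_real 0 + \<i> * of_real (s * \<tau>)))"
  proof -
    have "e (of_real h + \<i> * of_real (s * \<tau>))
        = e (of_real 0 + \<i> * of_real (s * \<tau>)) + 2 * of_real pi * (of_real s * \<i>)"
      using h by (simp add: e_def field_simps)
    moreover have "exp (2 * of_real pi * (of_real s * \<i>)) = 1"
      using s exp_two_pi_i exp_two_pi_i' by (auto simp: exp_minus)
    ultimately show ?thesis by (simp add: exp_add)
  qed
  ultimately show ?thesis
    by (simp add: e_def)
qed

lemma holomorphic_quotient_tendsto:
  assumes "open S" "z \<in> S" "f holomorphic_on S" "g holomorphic_on S"
    and "g z = 0 \<Longrightarrow> f z = 0 \<and> deriv g z \<noteq> 0"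
  shows "\<exists>c. ((\<lambda>w. f w / g w) \<longlongrightarrow> c) (at z)"
proof (cases "g z = 0")
  case True
  have "((\<lambda>w. f w / g w) \<longlongrightarrow> deriv f z / deriv g z) (at z)"
    using assms True by (intro lhopital_complex_simple) (auto intro!: holomorphic_derivI)
  then show ?thesis by blast
next
  case False
  have "isCont f z" "isCont g z"
    using assms by (meson holomorphic_on_imp_continuous_on continuous_on_eq_continuous_at)+
  then have "((\<lambda>w. f w / g w) \<longlongrightarrow> f z / g z) (at z)"
    using False by (intro tendsto_divide) (auto simp: isCont_def)
  then show ?thesis by blast
qed

text \<open>The weight \<open>1 / (exp (2 \<pi> i (z - t) / h) - 1)\<close> has residue \<open>h / (2 \<pi> i)\<close> at \<open>t\<close>, tends to
  \<open>-1\<close> above and to \<open>0\<close> below the real axis: comparing the period integrals of the weighted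
  difference \<open>F z - F t\<close> over the two lines \<open>Im z = \<plusminus>\<tau>\<close> isolates \<open>h * F t - C\<close>.\<close>

lemma periodic_value_minus_mean:
  fixes F P :: "complex \<Rightarrow> complex" and h t \<tau> \<sigma> :: real
  assumes h: "h > 0" and \<tau>: "0 < \<tau>" "\<tau> < \<sigma>"
    and holo: "F holomorphic_on strip \<sigma>"
    and per: "\<And>z. z \<in> strip \<sigma> \<Longrightarrow> F (z + of_real h) = F z"
    and P: "\<And>z. z \<in> strip \<sigma> \<Longrightarrow> (P has_field_derivative F z) (at z)"
    and C: "\<And>z. z \<in> strip \<sigma> \<Longrightarrow> P (z + of_real h) = P z + C"
    and M1: "\<And>x::real. norm (F (of_real x + \<i> * of_real \<tau>)) \<le> M1"
    and M2: "\<And>x::real. norm (F (of_real x + \<i> * of_real (- \<tau>))) \<le> M2"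
  shows "norm (of_real h * F (of_real t) - C)
    \<le> h * (M1 + M2) * (exp (- 2 * pi * \<tau> / h) / (1 - exp (- 2 * pi * \<tau> / h)))"
proof -
  define \<theta> where "\<theta> z = 2 * of_real pi * \<i> * (z - of_real t) / of_real h" for z :: complex
  define D0 where "D0 z = (F z - F (of_real t)) / (exp (\<theta> z) - 1)" for z
  define D where "D = remove_sings D0"
  define q where "q = exp (- 2 * pi * \<tau> / h)"
  have anF: "F analytic_on strip \<sigma>"
    using holo open_strip analytic_on_open by blast
  have t: "of_real t \<in> strip \<sigma>" using \<tau> by simp
  have \<theta>_deriv: "(\<theta> has_field_derivative 2 * of_real pi * \<i> / of_real h) (at z)" for z
    unfolding \<theta>_def using h by (auto intro!: derivative_eq_intros)
  have \<theta>_an: "\<theta> analytic_on A" for A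
    unfolding \<theta>_def using h by (auto intro!: analytic_intros)
  have \<theta>_period: "exp (\<theta> (z + of_real h)) = exp (\<theta> z)" for z
  proof -
    have "\<theta> (z + of_real h) = \<theta> z + 2 * of_real pi * \<i>"
      using h by (simp add: \<theta>_def field_simps)
    then show ?thesis by (simp add: exp_add)
  qed
  have zero: "F z = F (of_real t)" if "exp (\<theta> z) = 1" for z
  proof -
    have "exp (\<theta> z) = exp 0" using that by simp
    then obtain k :: int where "\<theta> z = of_int (2 * k) * of_real pi * \<i>"
      unfolding exp_eq by auto
    moreover have "z = of_real t + \<theta> z * (of_real h / (2 * of_real pi * \<i>))"
      using h by (simp add: \<theta>_def)
    ultimately have "z = of_real t + of_int (2 * k) * of_real pi * \<i> * (of_real h / (2 * of_real pi * \<i>))"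
      by metis
    then have "z = of_real t + of_real (of_int k * h)"
      by (simp add: algebra_simps)
    then show ?thesis
      using periodic_of_int[of \<sigma> F h "of_real t" k, OF per t] by simp
  qed
  \<comment> \<open>The denominator vanishes exactly at the points \<open>t + k * h\<close>, with
    nonzero derivative, and periodicity makes the numerator vanish there as well. All singularities
    of \<open>D0\<close> in the strip are therefore removable.\<close>
  have D_an: "D analytic_on strip \<sigma>"
    unfolding D_def
  proof (rule remove_sings_analytic_of_no_pole)
    show "D0 meromorphic_on strip \<sigma>"
      unfolding D0_def
      by (intro meromorphic_intros analytic_on_imp_meromorphic_on anF analytic_intros \<theta>_an)
    fix z assume z: "z \<in> strip \<sigma>"
    have "\<exists>c. ((\<lambda>w. (F w - F (of_real t)) / (exp (\<theta> w) - 1)) \<longlongrightarrow> c) (at z)"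
    proof (rule holomorphic_quotient_tendsto[OF open_strip z])
      show "(\<lambda>w. exp (\<theta> w) - 1) holomorphic_on strip \<sigma>"
        using \<theta>_an analytic_imp_holomorphic by (intro holomorphic_intros) blast
      have "deriv (\<lambda>w. exp (\<theta> w) - 1) z = exp (\<theta> z) * (2 * of_real pi * \<i> / of_real h)"
        by (rule DERIV_imp_deriv) (auto intro!: derivative_eq_intros \<theta>_deriv)
      then show "exp (\<theta> z) - 1 = 0 \<Longrightarrow> F z - F (of_real t) = 0 \<and>
          deriv (\<lambda>w. exp (\<theta> w) - 1) z \<noteq> 0"
        using zero h by simp
    qed (intro holomorphic_intros holo)
    then show "\<not> is_pole D0 z"
      unfolding is_pole_def D0_def
      using not_tendsto_and_filterlim_at_infinity[OF at_neq_bot] by blast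
  qed
  have D0_per: "D0 (z + of_real h) = D0 z" if "z \<in> strip \<sigma>" for z
    using per[OF that] \<theta>_period by (simp add: D0_def)
  have D_eq: "D z = D0 z" if "z \<in> strip \<sigma>" "exp (\<theta> z) \<noteq> 1" for z
    unfolding D_def
  proof (rule remove_sings_at_analytic)
    show "D0 analytic_on {z}"
      unfolding D0_def using that
      by (auto intro!: analytic_intros \<theta>_an intro: analytic_on_subset[OF anF])
  qed
  obtain PD CD where PD: "\<And>z. z \<in> strip \<sigma> \<Longrightarrow> (PD has_field_derivative D z) (at z)"
    and CD: "\<And>z. z \<in> strip \<sigma> \<Longrightarrow> PD (z + of_real h) = PD z + CD"
    using periodic_primitive[OF analytic_imp_holomorphic[OF D_an]
        remove_sings_periodic[of \<sigma> D0 h, OF D0_per, folded D_def]] by blast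
  have line: "((\<lambda>x. G (of_real x + \<i> * of_real y)) has_integral CG) {0..h}"
    if "\<bar>y\<bar> < \<sigma>" and "\<And>z. z \<in> strip \<sigma> \<Longrightarrow> (PG has_field_derivative G z) (at z)"
      and "\<And>z. z \<in> strip \<sigma> \<Longrightarrow> PG (z + of_real h) = PG z + CG" for G PG CG y
  proof -
    have mem: "of_real x + \<i> * of_real y \<in> strip \<sigma>" for x
      using that(1) by (simp add: strip_def)
    from this mem[of 0] has_integral_horizontal_line[of 0 h PG G y] that(2) that(3)[of "of_real 0 + \<i> * of_real y"] h show ?thesis by (simp add: add_ac)
  qed
  define k where "k s x = geom_kernel (of_real s * \<theta> (of_real x + \<i> * of_real (s * \<tau>)))" for s x :: real
  have k_int: "(k s has_integral 0) {0..h}" if "s \<in> {1, -1}" for s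
    using geom_kernel_integral[OF h \<tau>(1) that, of t] by (simp add: k_def[abs_def] \<theta>_def)
  have Re: "Re (of_real s * \<theta> (of_real x + \<i> * of_real (s * \<tau>))) = - 2 * pi * \<tau> / h"
    if "s \<in> {1, -1}" for s x
    using that h by (auto simp: \<theta>_def field_simps)
  have neg: "- 2 * pi * \<tau> / h < 0" using h \<tau> by simp
  have k_le: "norm (k s x) \<le> q / (1 - q)" if "s \<in> {1, -1}" for s x
    using norm_geom_kernel_le[of "of_real s * \<theta> (of_real x + \<i> * of_real (s * \<tau>))"] neg Re[OF that]
    by (simp add: k_def q_def)
  have ne: "exp (\<theta> (of_real x + \<i> * of_real (s * \<tau>))) \<noteq> 1" if "s \<in> {1, -1}" for s x
  proof
    assume "exp (\<theta> (of_real x + \<i> * of_real (s * \<tau>))) = 1"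
    then have "Re (\<theta> (of_real x + \<i> * of_real (s * \<tau>))) = 0"
      by (simp add: exp_eq_1)
    then show False using Re[OF that, of x] neg that by auto
  qed
  have st: "of_real x + \<i> * of_real (s * \<tau>) \<in> strip \<sigma>" if "s \<in> {1, -1}" for s x
    using that \<tau> by (auto simp: strip_def)
  \<comment> \<open>Below the axis the weight \<open>1 / (exp (\<theta> z) - 1)\<close> equals
    \<open>k (-1)\<close>. The integrand is \<open>D\<close> plus \<open>F t\<close> times a kernel
    with integral 0, so only the period integral \<open>CD\<close> of \<open>D\<close>
    remains.\<close>
  have low: "((\<lambda>x. F (of_real x + \<i> * of_real (- \<tau>)) * k (-1) x) has_integral CD) {0..h}"
  proof -
    have "((\<lambda>x. D (of_real x + \<i> * of_real (- \<tau>)) + F (of_real t) * k (-1) x) has_integral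
        CD + F (of_real t) * 0) {0..h}"
      using k_int[of "-1"] line[OF _ PD CD, of "- \<tau>"] \<tau>
      by (intro has_integral_add has_integral_mult_right) auto
    moreover have "D (of_real x + \<i> * of_real (- \<tau>)) + F (of_real t) * k (-1) x
        = F (of_real x + \<i> * of_real (- \<tau>)) * k (-1) x" for x
    proof -
      have "k (-1) x = 1 / (exp (\<theta> (of_real x + \<i> * of_real (- \<tau>))) - 1)"
        using ne[of "-1" x] by (simp add: k_def geom_kernel_def exp_minus field_simps)
      then show ?thesis
        using D_eq[OF st[of "-1" x] ne[of "-1" x]]
        by (simp add: D0_def diff_divide_distrib)
    qed
    ultimately show ?thesis by simp
  qed
  \<comment> \<open>Above the axis the same weight equals \<open>- 1 - k 1 x\<close>. The summand -1
    contributes \<open>h * F t - C\<close>, and \<open>CD\<close> appears again because the period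
    integral of \<open>D\<close> does not depend on the height.\<close>
  have up: "((\<lambda>x. F (of_real x + \<i> * of_real \<tau>) * k 1 x) has_integral
      of_real h * F (of_real t) - C - CD) {0..h}"
  proof -
    have "((\<lambda>x. F (of_real t) * k 1 x + F (of_real t) - F (of_real x + \<i> * of_real \<tau>)
        - D (of_real x + \<i> * of_real \<tau>)) has_integral
        F (of_real t) * 0 + (h - 0) *\<^sub>R F (of_real t) - C - CD) {0..h}"
      using k_int[of 1] line[OF _ PD CD, of \<tau>] line[OF _ P C, of \<tau>] \<tau> h
        has_integral_const_real[of "F (of_real t)" 0 h]
      by (intro has_integral_diff has_integral_add has_integral_mult_right) auto
    moreover have "F (of_real t) * k 1 x + F (of_real t) - F (of_real x + \<i> * of_real \<tau>)
        - D (of_real x + \<i> * of_real \<tau>) = F (of_real x + \<i> * of_real \<tau>) * k 1 x" for x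
    proof -
      define e where "e = exp (\<theta> (of_real x + \<i> * of_real \<tau>))"
      have e: "e \<noteq> 1" "e - 1 \<noteq> 0" "1 - e \<noteq> 0" using ne[of 1 x] by (auto simp: e_def)
      define w where "w = 1 / (e - 1)"
      have "k 1 x = e / (1 - e)"
        by (simp add: k_def geom_kernel_def e_def)
      also have "\<dots> = - 1 - w"
        using e by (simp add: field_simps w_def)
      finally have "k 1 x = - 1 - w" .
      moreover have "D (of_real x + \<i> * of_real \<tau>) =
          (F (of_real x + \<i> * of_real \<tau>) - F (of_real t)) * w"
        using D_eq[OF st[of 1 x] ne[of 1 x]] by (simp add: D0_def e_def w_def)
      ultimately show ?thesis
        by (simp only:) (simp add: algebra_simps)
    qed
    ultimately show ?thesis by (simp add: scaleR_conv_of_real)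
  qed
  have q: "0 \<le> q / (1 - q)" using neg by (simp add: q_def)
  have M: "0 \<le> M1" "0 \<le> M2"
    using M1[of 0] M2[of 0] norm_ge_zero order_trans by blast+
  have "norm CD \<le> (M2 * (q / (1 - q))) * measure lborel (cbox 0 h)"
    using low M q M2 k_le[of "-1"]
    by (intro has_integral_bound[of _ "\<lambda>x. F (of_real x + \<i> * of_real (- \<tau>)) * k (-1) x"])
       (auto simp: norm_mult intro!: mult_mono simp del: times_divide_eq_right)
  moreover have "norm (of_real h * F (of_real t) - C - CD) \<le> (M1 * (q / (1 - q))) * measure lborel (cbox 0 h)"
    using up M q M1 k_le[of 1]
    by (intro has_integral_bound[of _ "\<lambda>x. F (of_real x + \<i> * of_real \<tau>) * k 1 x"])
       (auto simp: norm_mult intro!: mult_mono simp del: times_divide_eq_right)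
  \<comment> \<open>The unknown \<open>CD\<close> is eliminated by adding the two estimates, which
    is why the bounds on the two lines enter as a sum.\<close>
  moreover have "norm (of_real h * F (of_real t) - C)
      \<le> norm (of_real h * F (of_real t) - C - CD) + norm CD"
    by (metis diff_add_cancel norm_triangle_ineq)
  ultimately show ?thesis
    using h unfolding q_def[symmetric] by (simp add: algebra_simps add_divide_distrib)
qed

text \<open>The one-node estimate is applied with period \<open>h = T / n\<close> to the sum of the
  \<open>n\<close> translates of \<open>F\<close>. Its primitive is the sum of the translates of
  \<open>P\<close>, and the bound on each line grows by the factor \<open>n\<close>, which turns
  \<open>h\<close> into \<open>T\<close>.\<close>

lemma trapezoidal_rule_error:
  fixes F P :: "complex \<Rightarrow> complex" and T t \<tau> \<sigma> :: real
  assumes T: "T > 0" and \<tau>: "0 < \<tau>" "\<tau> < \<sigma>" and n: "n > 0"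
    and holo: "F holomorphic_on strip \<sigma>"
    and per: "\<And>z. z \<in> strip \<sigma> \<Longrightarrow> F (z + of_real T) = F z"
    and P: "\<And>z. z \<in> strip \<sigma> \<Longrightarrow> (P has_field_derivative F z) (at z)"
    and C: "\<And>z. z \<in> strip \<sigma> \<Longrightarrow> P (z + of_real T) = P z + C"
    and M1: "\<And>x::real. norm (F (of_real x + \<i> * of_real \<tau>)) \<le> M1"
    and M2: "\<And>x::real. norm (F (of_real x + \<i> * of_real (- \<tau>))) \<le> M2"
  shows "norm (of_real (T / real n) * (\<Sum>j<n. F (of_real (t + real j * (T / real n)))) - C)
    \<le> T * (M1 + M2) * phi T n \<tau>"
proof -
  define h where "h = T / real n"
  have h: "h > 0" and nh: "real n * h = T" using T n by (auto simp: h_def)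
  \<comment> \<open>Moving all translates by \<open>h\<close> replaces the first one by the
    translate by \<open>T\<close>. The difference \<open>G (z + T) - G z\<close> is 0 for
    \<open>G = F\<close>, giving the period \<open>h\<close>, and \<open>C\<close> for
    \<open>G = P\<close>, so the increment of the summed primitive over \<open>h\<close> is again
    \<open>C\<close>.\<close>
  have shift: "(\<Sum>j<n. G (z + of_real h + of_real (real j * h)))
      = (\<Sum>j<n. G (z + of_real (real j * h))) + (G (z + of_real T) - G z)"
    for G :: "complex \<Rightarrow> complex" and z
  proof -
    have "(\<Sum>j<n. G (z + of_real h + of_real (real j * h)) - G (z + of_real (real j * h)))
        = (\<Sum>j<n. G (z + of_real (real (Suc j) * h)) - G (z + of_real (real j * h)))"
      by (simp add: algebra_simps)
    also have "\<dots> = G (z + of_real T) - G z"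
      by (subst sum_lessThan_telescope) (simp add: nh)
    finally show ?thesis by (simp add: sum_subtractf algebra_simps)
  qed
  have nM: "norm (\<Sum>j<n. F (of_real x + \<i> * of_real y + of_real (real j * h))) \<le> real n * M"
    if "\<And>x::real. norm (F (of_real x + \<i> * of_real y)) \<le> M" for x y M
  proof -
    have "norm (F (of_real x + \<i> * of_real y + of_real (real j * h))) \<le> M" for j
      using that[of "x + real j * h"] by (simp add: algebra_simps)
    then show ?thesis
      by (intro order_trans[OF sum_norm_bound[of "{..<n}"]]) auto
  qed
  have "norm (of_real h * (\<Sum>j<n. F (of_real t + of_real (real j * h))) - C)
      \<le> h * (real n * M1 + real n * M2) * (exp (- 2 * pi * \<tau> / h) / (1 - exp (- 2 * pi * \<tau> / h)))"
  proof (rule periodic_value_minus_mean[where F = "\<lambda>z. \<Sum>j<n. F (z + of_real (real j * h))"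
        and P = "\<lambda>z. \<Sum>j<n. P (z + of_real (real j * h))"])
    have "(\<lambda>z. F (z + of_real (real j * h))) holomorphic_on strip \<sigma>" for j
      using holomorphic_on_compose_gen[OF _ holo, of "\<lambda>z. z + of_real (real j * h)" "strip \<sigma>"]
      by (force simp: o_def strip_def intro: holomorphic_intros)
    then show "(\<lambda>z. \<Sum>j<n. F (z + of_real (real j * h))) holomorphic_on strip \<sigma>"
      by (intro holomorphic_intros)
    show "((\<lambda>z. \<Sum>j<n. P (z + of_real (real j * h))) has_field_derivative
        (\<Sum>j<n. F (z + of_real (real j * h)))) (at z)" if "z \<in> strip \<sigma>" for z
      using that P by (intro DERIV_sum) (subst DERIV_shift[symmetric], simp only: strip_add_of_real)
    show "(\<Sum>j<n. F (z + of_real h + of_real (real j * h))) = (\<Sum>j<n. F (z + of_real (real j * h)))"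
      if "z \<in> strip \<sigma>" for z
      using shift[of F z] per[OF that] by simp
    show "(\<Sum>j<n. P (z + of_real h + of_real (real j * h))) = (\<Sum>j<n. P (z + of_real (real j * h))) + C"
      if "z \<in> strip \<sigma>" for z
      using shift[of P z] C[OF that] by simp
  qed (rule h \<tau> nM M1 M2)+
  moreover have "- 2 * pi * \<tau> / h = - 2 * real n * pi * \<tau> / T"
    using T n by (simp add: h_def field_simps)
  moreover have "h * (real n * M1 + real n * M2) = T * (M1 + M2)"
    using nh by (simp add: algebra_simps)
  ultimately show ?thesis
    by (simp only: phi_def of_real_add h_def[symmetric])
qed

subsection \<open>Sums of squared cosecants over equidistant nodes\<close>

lemma sum_power_roots_unity:
  assumes "k < n"
  shows "(\<Sum>j<n. exp (2 * of_real pi * \<i> * of_nat j / of_nat n) ^ k) = (if k = 0 then of_nat n else 0 :: complex)"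
proof (cases "k = 0")
  case False
  define \<zeta> where "\<zeta> = exp (2 * of_real pi * \<i> * of_nat k / of_nat n)"
  have "\<zeta> \<noteq> 1"
    using complex_root_unity_eq_1[of n k] assms False by (auto simp: \<zeta>_def dest: dvd_imp_le)
  moreover have "\<zeta> ^ n = 1"
    using complex_root_unity[of n k] assms by (simp add: \<zeta>_def)
  then have "(1 - \<zeta>) * (\<Sum>j<n. \<zeta> ^ j) = 0"
    by (subst one_diff_power_eq[symmetric]) simp
  moreover have "exp (2 * of_real pi * \<i> * of_nat j / of_nat n) ^ k = \<zeta> ^ j" for j
    by (simp add: \<zeta>_def exp_of_nat_mult[symmetric] algebra_simps)
  ultimately show ?thesis using False by simp
qed simp

text \<open>As each root of unity \<open>\<zeta> j\<close> has n-th power 1,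
  \<open>1 / (1 - \<zeta> j * v)\<close> is a finite geometric sum divided by the common denominator
  \<open>1 - v ^ n\<close>. Summation over \<open>j\<close> annihilates every power of
  \<open>\<zeta> j\<close> except the zeroth.\<close>

lemma sum_inverse_one_minus_roots_unity:
  fixes v :: complex
  assumes v: "v ^ n \<noteq> 1"
  shows "(\<Sum>j<n. 1 / (1 - exp (2 * of_real pi * \<i> * of_nat j / of_nat n) * v)) = of_nat n / (1 - v ^ n)"
proof -
  define \<zeta> where "\<zeta> j = exp (2 * of_real pi * \<i> * of_nat j / of_nat n)" for j :: nat
  have n: "n > 0" using v by (cases n) auto
  have "1 / (1 - \<zeta> j * v) = (\<Sum>k<n. (\<zeta> j * v) ^ k) / (1 - v ^ n)" for j
  proof -
    have "\<zeta> j ^ n = 1" using complex_root_unity[of n j] n by (simp add: \<zeta>_def)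
    then have *: "1 - v ^ n = (1 - \<zeta> j * v) * (\<Sum>k<n. (\<zeta> j * v) ^ k)"
      using one_diff_power_eq[of "\<zeta> j * v" n] by (simp add: power_mult_distrib)
    then have "(1 - \<zeta> j * v) \<noteq> 0" "(\<Sum>k<n. (\<zeta> j * v) ^ k) \<noteq> 0" using v by auto
    then show ?thesis by (simp add: *)
  qed
  then have "(\<Sum>j<n. 1 / (1 - \<zeta> j * v)) = (\<Sum>j<n. \<Sum>k<n. \<zeta> j ^ k * v ^ k) / (1 - v ^ n)"
    by (simp add: sum_divide_distrib power_mult_distrib)
  also have "(\<Sum>j<n. \<Sum>k<n. \<zeta> j ^ k * v ^ k) = (\<Sum>k<n. (\<Sum>j<n. \<zeta> j ^ k) * v ^ k)"
    by (subst sum.swap) (simp add: sum_distrib_right)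
  also have "\<dots> = (\<Sum>k<n. if k = 0 then of_nat n else 0)"
    by (intro sum.cong) (auto simp: \<zeta>_def sum_power_roots_unity)
  also have "\<dots> = of_nat n" using n by simp
  finally show ?thesis by (simp add: \<zeta>_def)
qed

lemma cot_conv_exp:
  assumes "sin (x :: complex) \<noteq> 0"
  shows "exp (2 * \<i> * x) \<noteq> 1" and "cot x = \<i> * (1 - 2 * (1 / (1 - exp (2 * \<i> * x))))"
proof -
  define e where "e = exp (\<i> * x)"
  have e: "e \<noteq> 0" "exp (2 * \<i> * x) = e ^ 2" "exp (- (\<i> * x)) = 1 / e"
    by (simp_all add: e_def exp_minus field_simps flip: exp_double)
  have s: "sin x = (e - 1 / e) / (2 * \<i>)" "cos x = (e + 1 / e) / 2"
    using e(3) by (simp_all add: sin_exp_eq cos_exp_eq e_def)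
  from assms s(1) e(1) have ne: "e ^ 2 \<noteq> 1" by (auto simp: field_simps power2_eq_square)
  then show "exp (2 * \<i> * x) \<noteq> 1" using e by simp
  have ne': "1 - e ^ 2 \<noteq> 0" "e ^ 2 - 1 \<noteq> 0" using ne by auto
  have s': "sin x = (e ^ 2 - 1) / (2 * \<i> * e)" "cos x = (e ^ 2 + 1) / (2 * e)"
    using e(1) by (simp_all add: s field_simps power2_eq_square)
  have "cot x = \<i> * ((e ^ 2 + 1) / (e ^ 2 - 1))"
    using e(1) ne' by (simp add: cot_def s')
  also have "(e ^ 2 + 1) / (e ^ 2 - 1) = 1 - 2 * (1 / (1 - e ^ 2))"
    using ne' by (simp add: field_simps)
  finally show "cot x = \<i> * (1 - 2 * (1 / (1 - exp (2 * \<i> * x))))"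
    using e by simp
qed

lemma sin_shift_nonzero:
  fixes x :: real
  assumes "sin (real n * x) \<noteq> 0"
  shows "sin (x + real j * pi / real n) \<noteq> 0"
proof
  assume "sin (x + real j * pi / real n) = 0"
  then obtain i :: int where "x + real j * pi / real n = of_int i * pi"
    using sin_zero_iff_int2 by blast
  then have "real n * x = of_int (i * int n - int j) * pi"
    using assms by (cases "n = 0") (auto simp: field_simps)
  then show False using assms sin_zero_iff_int2 by blast
qed

text \<open>Shifting the argument by \<open>j * pi / n\<close> multiplies
  \<open>v = exp (2 * \<i> * x)\<close> by an n-th root of unity. Since \<open>cot\<close> is affine
  in \<open>1 / (1 - v)\<close>, the sum over the roots of unity evaluates it.\<close>

lemma sum_cot_equidistant:
  fixes x :: real
  assumes "sin (real n * x) \<noteq> 0"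
  shows "(\<Sum>j<n. cot (x + real j * pi / real n)) = real n * cot (real n * x)"
proof -
  define v where "v = exp (2 * \<i> * of_real x)"
  have vn: "v ^ n = exp (2 * \<i> * of_real (real n * x))"
    by (simp add: v_def exp_of_nat_mult[symmetric] algebra_simps)
  have "sin (of_real (real n * x)) \<noteq> (0 :: complex)"
    using assms by (simp only: sin_of_real of_real_eq_0_iff not_False_eq_True)
  note n = cot_conv_exp[OF this, folded vn]
  have "of_real (cot (x + real j * pi / real n)) =
      \<i> * (1 - 2 * (1 / (1 - exp (2 * of_real pi * \<i> * of_nat j / of_nat n) * v)))" for j
  proof -
    have "sin (of_real (x + real j * pi / real n)) \<noteq> (0 :: complex)"
      using sin_shift_nonzero[OF assms] by (simp only: sin_of_real of_real_eq_0_iff not_False_eq_True)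
    from cot_conv_exp(2)[OF this] show ?thesis
      unfolding cot_of_real by (simp add: v_def exp_add[symmetric] algebra_simps)
  qed
  then have "of_real (\<Sum>j<n. cot (x + real j * pi / real n)) =
      (\<Sum>j<n. \<i> * (1 - 2 * (1 / (1 - exp (2 * of_real pi * \<i> * of_nat j / of_nat n) * v))))"
    by (simp only: of_real_sum)
  also have "\<dots> =
      \<i> * (of_nat n - 2 * (\<Sum>j<n. 1 / (1 - exp (2 * of_real pi * \<i> * of_nat j / of_nat n) * v)))"
    by (simp add: sum_distrib_left sum_subtractf algebra_simps)
  also have "\<dots> = of_nat n * (\<i> * (1 - 2 * (1 / (1 - v ^ n))))"
    using sum_inverse_one_minus_roots_unity[of v n] n(1) by (simp add: algebra_simps)
  also have "\<dots> = of_real (real n * cot (real n * x))"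
    using n(2) by (simp only: of_real_mult of_real_of_nat_eq cot_of_real)
  finally show ?thesis by (simp only: of_real_eq_iff)
qed

text \<open>This is the derivative of the cotangent identity. For that the identity must hold on a
  neighbourhood of \<open>x\<close>, which continuity of \<open>sin (n * x)\<close>
  provides.\<close>

lemma sum_csc_squared_equidistant:
  fixes x :: real
  assumes nz: "sin (real n * x) \<noteq> 0"
  shows "(\<Sum>j<n. 1 / sin (x + real j * pi / real n) ^ 2) = (real n) ^ 2 / sin (real n * x) ^ 2"
proof -
  have "isCont (\<lambda>y. sin (real n * y)) x" by (intro continuous_intros)
  then have "\<forall>\<^sub>F y in nhds x. sin (real n * y) \<noteq> 0"
    unfolding isCont_def using tendsto_at_iff_tendsto_nhds nz
    by (intro tendsto_imp_eventually_ne) blast+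
  then have ev: "\<forall>\<^sub>F y in nhds x. (\<Sum>j<n. cot (y + real j * pi / real n)) = real n * cot (real n * y)"
    by eventually_elim (rule sum_cot_equidistant)
  have "((\<lambda>y. \<Sum>j<n. cot (y + real j * pi / real n)) has_real_derivative
      (\<Sum>j<n. - inverse ((sin (x + real j * pi / real n))\<^sup>2) * 1)) (at x)"
    by (intro DERIV_sum DERIV_chain2[OF DERIV_cot] sin_shift_nonzero[OF nz])
       (auto intro!: derivative_eq_intros)
  moreover have "((\<lambda>y. real n * cot (real n * y)) has_real_derivative
      real n * (- inverse ((sin (real n * x))\<^sup>2) * real n)) (at x)"
    by (intro DERIV_cmult DERIV_chain2[OF DERIV_cot] nz) (auto intro!: derivative_eq_intros)
  ultimately have "(\<Sum>j<n. - inverse ((sin (x + real j * pi / real n))\<^sup>2) * 1) =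
      real n * (- inverse ((sin (real n * x))\<^sup>2) * real n)"
    using DERIV_cong_ev[OF refl ev refl] DERIV_unique by metis
  then show ?thesis
    by (simp add: sum_negf divide_inverse power2_eq_square)
qed

lemma sum_csc_squared_midpoints:
  assumes "n > 0"
  shows "(\<Sum>j=1..n. 1 / sin (pi * (real j - 1/2) / real n) ^ 2) = (real n) ^ 2"
proof -
  have "(\<Sum>j=1..n. 1 / sin (pi * (real j - 1/2) / real n) ^ 2)
      = (\<Sum>j<n. 1 / sin (pi * (real (Suc j) - 1/2) / real n) ^ 2)"
    by (rule sum.reindex_bij_witness[of _ Suc "\<lambda>j. j - 1"]) auto
  \<comment> \<open>The midpoints are the equidistant nodes started at
    \<open>x = pi / (2 * n)\<close>, where \<open>sin (n * x) = 1\<close>.\<close>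
  also have "\<dots> = (\<Sum>j<n. 1 / sin (pi / (2 * real n) + real j * pi / real n) ^ 2)"
    using assms by (simp add: field_simps)
  also have "\<dots> = (real n) ^ 2"
    using assms by (subst sum_csc_squared_equidistant) auto
  finally show ?thesis .
qed

text \<open>The start \<open>x = 0\<close> is singular, so the term \<open>j = 0\<close> is moved to
  the other side before \<open>x\<close> tends to 0. From 1/sin(y)^2 = 1/y^2 + 1/3 + o(1) the poles
  of \<open>n^2 / sin (n * x)^2\<close> and \<open>1 / sin x ^ 2\<close> cancel, and
  \<open>(n^2 - 1) / 3\<close> remains.\<close>

lemma sum_csc_squared_nodes:
  assumes "n > 0"
  shows "(\<Sum>j=1..n-1. 1 / sin (pi * real j / real n) ^ 2) = ((real n) ^ 2 - 1) / 3"
proof -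
  define S where "S x = (\<Sum>j=1..n-1. 1 / sin (x + pi * real j / real n) ^ 2)" for x
  have "(S \<longlongrightarrow> S 0) (at_right 0)"
    unfolding S_def
  proof (intro tendsto_intros)
    fix j assume j: "j \<in> {1..n-1}"
    then have "0 < pi * real j / real n" "pi * real j / real n < pi"
      using assms by (auto simp: field_simps)
    then show "sin (0 + pi * real j / real n) ^ 2 \<noteq> 0"
      using sin_gt_zero by force
  qed
  moreover have "(S \<longlongrightarrow> ((real n) ^ 2 - 1) / 3) (at_right 0)"
  proof (rule Lim_transform_eventually)
    have "real n > 0" using assms by simp
    then show "((\<lambda>x. (real n) ^ 2 / sin (real n * x) ^ 2 - 1 / sin x ^ 2) \<longlongrightarrow> ((real n) ^ 2 - 1) / 3) (at_right 0)"
      by real_asymp (simp add: field_simps power2_eq_square)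
    have "\<forall>\<^sub>F x in at_right 0. x \<in> {0<..<pi / real n}"
      using assms by (intro eventually_at_right_real) simp
    then show "\<forall>\<^sub>F x in at_right 0. (real n) ^ 2 / sin (real n * x) ^ 2 - 1 / sin x ^ 2 = S x"
    proof eventually_elim
      case (elim x)
      then have "sin (real n * x) > 0" using assms
        by (intro sin_gt_zero) (auto simp: field_simps)
      then have "(\<Sum>j<n. 1 / sin (x + real j * pi / real n) ^ 2) = (real n) ^ 2 / sin (real n * x) ^ 2"
        by (intro sum_csc_squared_equidistant) auto
      moreover have "{..<n} = insert 0 {1..n-1}" using assms by auto
      ultimately show ?case by (simp add: S_def mult.commute)
    qed
  qed
  ultimately have "S 0 = ((real n) ^ 2 - 1) / 3"
    by (intro tendsto_unique[OF trivial_limit_at_right_real])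
  then show ?thesis by (simp add: S_def)
qed

lemma sum_antisymmetric_eq_0:
  fixes f :: "nat \<Rightarrow> real"
  assumes "\<And>j. j \<in> {1..m} \<Longrightarrow> f (Suc m - j) = - f j"
  shows "(\<Sum>j=1..m. f j) = 0"
proof -
  have "(\<Sum>j=1..m. f j) = (\<Sum>j=1..m. f (Suc m - j))"
    by (rule sum.reindex_bij_witness[of _ "\<lambda>j. Suc m - j" "\<lambda>j. Suc m - j"]) auto
  also have "\<dots> = - (\<Sum>j=1..m. f j)"
    using assms by (simp add: sum_negf)
  finally show ?thesis by simp
qed

subsection \<open>Expansions along the real axis\<close>

lemma Taylor_remainder_bound:
  fixes f :: "complex \<Rightarrow> complex"
  assumes "f analytic_on {z}"
  obtains B r where "r > 0" and "\<And>w. w \<in> cball z r \<Longrightarrow>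
    norm (f w - (\<Sum>i\<le>n. (deriv ^^ i) f z * (w - z) ^ i / fact i)) \<le> B * norm (w - z) ^ Suc n"
proof -
  obtain S where S: "open S" "z \<in> S" "f holomorphic_on S"
    using assms analytic_at by blast
  then obtain r where r: "r > 0" "cball z r \<subseteq> S"
    using open_contains_cball by blast
  have hol: "(deriv ^^ i) f holomorphic_on S" for i
    using S by (intro holomorphic_higher_deriv)
  have "continuous_on (cball z r) ((deriv ^^ Suc n) f)"
    using holomorphic_on_subset[OF hol r(2)] holomorphic_on_imp_continuous_on by blast
  then have "bounded ((deriv ^^ Suc n) f ` cball z r)"
    by (intro compact_imp_bounded compact_continuous_image) auto
  then obtain B where B: "\<And>w. w \<in> cball z r \<Longrightarrow> norm ((deriv ^^ Suc n) f w) \<le> B"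
    unfolding bounded_iff by blast
  have "norm (f w - (\<Sum>i\<le>n. (deriv ^^ i) f z * (w - z) ^ i / fact i)) \<le> B / fact n * norm (w - z) ^ Suc n"
    if w: "w \<in> cball z r" for w
  proof -
    have "((deriv ^^ i) f has_field_derivative (deriv ^^ Suc i) f x) (at x within cball z r)"
      if "x \<in> cball z r" for i x
      using holomorphic_derivI[OF hol[of i] S(1)] that r(2) by auto
    from complex_Taylor[of "cball z r" n "\<lambda>i. (deriv ^^ i) f" B z w, OF convex_cball this B] w r(1)
    show ?thesis by simp
  qed
  then show ?thesis using that r(1) by blast
qed

lemma Taylor_remainder_tendsto:
  fixes f :: "complex \<Rightarrow> complex"
  assumes "f analytic_on {z}"
  shows "((\<lambda>x. (f (z + of_real x) - (\<Sum>i\<le>n. (deriv ^^ i) f z * of_real x ^ i / fact i)) / of_real x ^ n)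
    \<longlongrightarrow> 0) (at_right 0)"
proof -
  obtain B r where r: "r > 0" and B: "\<And>w. w \<in> cball z r \<Longrightarrow>
      norm (f w - (\<Sum>i\<le>n. (deriv ^^ i) f z * (w - z) ^ i / fact i)) \<le> B * norm (w - z) ^ Suc n"
    using Taylor_remainder_bound[OF assms] by blast
  have "\<forall>\<^sub>F x::real in at_right 0. x \<in> {0<..<r}"
    using r by (rule eventually_at_right_real)
  then have "\<forall>\<^sub>F x in at_right 0.
      norm ((f (z + of_real x) - (\<Sum>i\<le>n. (deriv ^^ i) f z * of_real x ^ i / fact i)) / of_real x ^ n) \<le> B * x"
  proof eventually_elim
    case (elim x)
    then have "z + of_real x \<in> cball z r" by (simp add: dist_norm)
    from B[OF this] elim show ?case
      by (simp add: norm_divide norm_power field_simps)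
  qed
  then show ?thesis
    by (rule Lim_null_comparison) (auto intro!: tendsto_eq_intros)
qed

text \<open>The Taylor coefficients of an analytic function are determined by its values on one real
  half-line. This permits two analytic functions to be compared up to order \<open>m\<close> by a
  real limit, without differentiating a quotient.\<close>

lemma higher_deriv_eq_0_of_real_tendsto:
  fixes f :: "complex \<Rightarrow> complex"
  assumes an: "f analytic_on {z}"
    and lim: "((\<lambda>x. f (z + of_real x) / of_real x ^ m) \<longlongrightarrow> 0) (at_right 0)"
    and "k \<le> m"
  shows "(deriv ^^ k) f z = 0"
  using \<open>k \<le> m\<close>
proof (induction k rule: less_induct)
  case (less k)
  have pos: "\<forall>\<^sub>F x::real in at_right 0. x > 0"
    by (simp add: eventually_at_right_less)
  have "((\<lambda>x. of_real x ^ (m - k) :: complex) \<longlongrightarrow> of_real 0 ^ (m - k)) (at_right 0)"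
    by (intro tendsto_intros)
  \<comment> \<open>Both terms tend to 0: the first is \<open>f / x ^ k\<close>, the second the
    Taylor remainder over \<open>x ^ k\<close>. As the lower coefficients vanish by induction, their
    difference is exactly the k-th coefficient.\<close>
  then have "((\<lambda>x. f (z + of_real x) / of_real x ^ m * of_real x ^ (m - k)
      - (f (z + of_real x) - (\<Sum>i\<le>k. (deriv ^^ i) f z * of_real x ^ i / fact i)) / of_real x ^ k)
      \<longlongrightarrow> 0 * of_real 0 ^ (m - k) - 0) (at_right 0)"
    by (intro tendsto_diff tendsto_mult lim Taylor_remainder_tendsto[OF an])
  moreover have "\<forall>\<^sub>F x in at_right 0. f (z + of_real x) / of_real x ^ m * of_real x ^ (m - k)
      - (f (z + of_real x) - (\<Sum>i\<le>k. (deriv ^^ i) f z * of_real x ^ i / fact i)) / of_real x ^ k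
      = (deriv ^^ k) f z / fact k"
    using pos
  proof eventually_elim
    case (elim x)
    have "(\<Sum>i\<le>k. (deriv ^^ i) f z * of_real x ^ i / fact i)
        = (\<Sum>i\<le>k. if i = k then (deriv ^^ k) f z * of_real x ^ k / fact k else 0)"
      using less by (intro sum.cong) auto
    also have "\<dots> = (deriv ^^ k) f z * of_real x ^ k / fact k" by simp
    finally have S: "(\<Sum>i\<le>k. (deriv ^^ i) f z * of_real x ^ i / fact i) = (deriv ^^ k) f z * of_real x ^ k / fact k" .
    have "of_real x ^ m = (of_real x ^ k * of_real x ^ (m - k) :: complex)"
      using less.prems by (simp flip: power_add)
    then show ?case
      using elim unfolding S by (simp add: field_simps)
  qed
  ultimately have "((\<lambda>x::real. (deriv ^^ k) f z / fact k) \<longlongrightarrow> 0 * of_real 0 ^ (m - k) - 0) (at_right 0)"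
    by (rule Lim_transform_eventually)
  then show ?case
    using tendsto_unique[OF trivial_limit_at_right_real] tendsto_const by fastforce
qed

lemma filterlim_real_approach:
  "filterlim (\<lambda>x::real. z + of_real x) (at (z :: complex)) (at_right 0)"
proof -
  have "((\<lambda>x::real. z + of_real x) \<longlongrightarrow> z + of_real 0) (at_right 0)"
    by (intro tendsto_intros)
  then show ?thesis
    by (auto simp: filterlim_at eventually_at_filter)
qed

text \<open>A pole forces divergence along every approach, hence also along the real axis from the
  right.\<close>

lemma not_is_pole_of_real_tendsto:
  fixes f :: "complex \<Rightarrow> complex"
  assumes "((\<lambda>x::real. f (z + of_real x)) \<longlongrightarrow> c) (at_right 0)"
  shows "\<not> is_pole f z"
proof
  assume "is_pole f z"
  then have "filterlim (\<lambda>x::real. f (z + of_real x)) at_infinity (at_right 0)"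
    unfolding is_pole_def by (rule filterlim_compose[OF _ filterlim_real_approach])
  then show False
    using assms not_tendsto_and_filterlim_at_infinity trivial_limit_at_right_real by blast
qed

text \<open>The equality is carried through the induction on a whole neighbourhood of
  \<open>t\<close>, since the next derivative at a point depends on the values nearby.\<close>

lemma eventually_rderiv_eq:
  assumes an: "G analytic_on {of_real t}"
    and eq: "\<forall>\<^sub>F x in nhds t. g x = G (of_real x)"
  shows "\<forall>\<^sub>F x in nhds t. rderiv k g x = (deriv ^^ k) G (of_real x)"
proof (induction k)
  case 0
  then show ?case using eq by (simp add: rderiv_def)
next
  case (Suc k)
  have "(deriv ^^ k) G analytic_on {of_real t}"
    using an by (rule analytic_higher_deriv)
  then obtain S where S: "open S" "of_real t \<in> S" "(deriv ^^ k) G holomorphic_on S"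
    using analytic_at by blast
  have "filterlim of_real (nhds (of_real t :: complex)) (nhds t)"
    by (intro tendsto_of_real filterlim_ident)
  with eventually_nhds_in_open[OF S(1,2)] have "\<forall>\<^sub>F x in nhds t. of_real x \<in> S"
    by (rule eventually_compose_filterlim)
  moreover have "\<forall>\<^sub>F x in nhds t. \<forall>\<^sub>F y in nhds x. rderiv k g y = (deriv ^^ k) G (of_real y)"
    using Suc.IH by (simp add: eventually_eventually)
  ultimately show ?case
  proof eventually_elim
    case (elim x)
    have "((\<lambda>y. (deriv ^^ k) G (of_real y)) has_vector_derivative deriv ((deriv ^^ k) G) (of_real x)) (at x)"
      using elim S by (intro has_vector_derivative_real_field holomorphic_derivI[of _ S])
    moreover have "vector_derivative (rderiv k g) (at x) =
        vector_derivative (\<lambda>y. (deriv ^^ k) G (of_real y)) (at x)"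
      using elim by (intro vector_derivative_cong_eq) auto
    ultimately show ?case
      by (simp add: rderiv_def vector_derivative_at)
  qed
qed

text \<open>Laurent expansions with \<open>s = pi / T\<close>. The first three are the factors of
  u', u'' and u''' in the limit of \<open>F1\<close> at \<open>t\<close>; the fourth says that
  \<open>x ^ 3\<close> times the kernel is constant up to o(x^3); the fifth removes the pole of the
  cotangent in the finite part.\<close>

lemma trig_limits:
  fixes s :: real
  assumes "s > 0"
  shows "((\<lambda>x. x * (cos (s * x) / sin (s * x) ^ 3) - 1 / (s * sin (s * x) ^ 2)) \<longlongrightarrow> - 1 / (3 * s)) (at_right 0)"
    and "((\<lambda>x. x ^ 2 * (cos (s * x) / sin (s * x) ^ 3) - cos (s * x) / (s ^ 2 * sin (s * x))) \<longlongrightarrow> 0) (at_right 0)"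
    and "((\<lambda>x. x ^ 3 * (cos (s * x) / sin (s * x) ^ 3)) \<longlongrightarrow> 1 / s ^ 3) (at_right 0)"
    and "((\<lambda>x. (x ^ 3 * (cos (s * x) / sin (s * x) ^ 3) - 1 / s ^ 3) / x ^ 3) \<longlongrightarrow> 0) (at_right 0)"
    and "((\<lambda>x. cos (s * x) / sin (s * x) / s  - 1 / (s ^ 2 * x)) \<longlongrightarrow> 0) (at_right 0)"
  using assms by (real_asymp simp: field_simps power_numeral_reduce)+

subsection \<open>The regularised integrand\<close>

locale periodic_strip =
  fixes T t \<sigma> :: real and u :: "complex \<Rightarrow> complex"
  assumes T_pos: "T > 0" and \<sigma>_pos: "\<sigma> > 0"
    and u_analytic: "u analytic_on strip \<sigma>"
    and u_periodic: "\<And>z. z \<in> strip \<sigma> \<Longrightarrow> u (z + of_real T) = u z"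
begin

abbreviation arg :: "complex \<Rightarrow> complex" where
  "arg z \<equiv> of_real pi * (z - of_real t) / of_real T"

abbreviation (input) u0 where "u0 \<equiv> u (of_real t)"
abbreviation (input) u1 where "u1 \<equiv> deriv u (of_real t)"
abbreviation (input) u2 where "u2 \<equiv> (deriv ^^ 2) u (of_real t)"
abbreviation (input) u3 where "u3 \<equiv> (deriv ^^ 3) u (of_real t)"

lemma t_in_strip: "of_real t \<in> strip \<sigma>"
  using \<sigma>_pos by simp

lemma u_analytic_at: "z \<in> strip \<sigma> \<Longrightarrow> u analytic_on {z}"
  using u_analytic by (rule analytic_on_subset) simp

lemma arg_analytic: "arg analytic_on A"
  using T_pos by (intro analytic_intros) auto

lemma arg_has_field_derivative: "(arg has_field_derivative of_real pi / of_real T) (at z)"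
  using T_pos by (auto intro!: derivative_eq_intros)

lemma arg_of_real: "arg (of_real x) = of_real (pi * (x - t) / T)"
  by simp

lemma arg_period: "arg (z + of_real T) = arg z + of_real pi"
  using T_pos by (simp add: field_simps)

lemma sin_arg_period: "sin (arg (z + of_real T)) = - sin (arg z)"
  and cos_arg_period: "cos (arg (z + of_real T)) = - cos (arg z)"
  unfolding arg_period by (simp_all add: sin_add cos_add sin_of_real cos_of_real)

lemma trig_kernel_periodic: "trig_kernel T t (z + of_real T) = trig_kernel T t z"
  unfolding trig_kernel_def sin_arg_period cos_arg_period by simp

lemma F1_formula_periodic:
  "z \<in> strip \<sigma> \<Longrightarrow> F1_formula T t u (z + of_real T) = F1_formula T t u z"
  unfolding F1_formula_def trig_kernel_periodic tan_def sin_arg_period cos_arg_period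
  by (simp add: u_periodic)

lemma trig_kernel_of_real:
  "trig_kernel T t (of_real x) = of_real (cos (pi * (x - t) / T) / sin (pi * (x - t) / T) ^ 3)"
  unfolding trig_kernel_def arg_of_real sin_of_real cos_of_real by simp

text \<open>The factor \<open>cos\<close> of the kernel cancels the poles of \<open>tan\<close>.\<close>

definition F1_expanded :: "complex \<Rightarrow> complex" where
  "F1_expanded z = trig_kernel T t z * (u z - u0) - of_real (T / pi) * u1 / sin (arg z) ^ 2
    - of_real (T ^ 2 / (2 * pi ^ 2)) * u2 * cos (arg z) / sin (arg z)"

lemma F1_formula_eq_expanded:
  assumes "sin (arg z) \<noteq> 0" "cos (arg z) \<noteq> 0"
  shows "F1_formula T t u z = F1_expanded z"
proof -
  define S C where "S = sin (arg z)" and "C = cos (arg z)"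
  have "S \<noteq> 0" "C \<noteq> 0" using assms by (auto simp: S_def C_def)
  then have "C / S ^ 3 * (a - b - c * (S / C) - d * S ^ 2) = C / S ^ 3 * (a - b) - c / S ^ 2 - d * C / S"
    for a b c d :: complex
    by (simp add: field_simps power2_eq_square power3_eq_cube)
  then show ?thesis
    unfolding F1_formula_def F1_expanded_def trig_kernel_def tan_def S_def C_def by blast
qed

text \<open>The zeros of the cosine are simple, hence isolated. This is what allows a limit of
  \<open>F1_formula\<close> to be computed from \<open>F1_expanded\<close> even at a zero of the
  cosine.\<close>

lemma eventually_cos_arg_nonzero: "\<forall>\<^sub>F w in at z. cos (arg w) \<noteq> 0"
proof (cases "cos (arg z) = 0")
  case True
  then have "sin (arg z) \<noteq> 0"
    using sin_cos_squared_add[of "arg z"] by auto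
  have "((\<lambda>w. cos (arg w)) has_field_derivative - sin (arg z) * (of_real pi / of_real T)) (at z)"
    by (intro DERIV_chain2[OF DERIV_cos] arg_has_field_derivative)
  from has_field_derivativeD[OF this] have "((\<lambda>w. cos (arg w) / (w - z)) \<longlongrightarrow>
      - sin (arg z) * (of_real pi / of_real T)) (at z)"
    using True by simp
  then have "\<forall>\<^sub>F w in at z. cos (arg w) / (w - z) \<noteq> 0"
    by (rule tendsto_imp_eventually_ne) (use \<open>sin (arg z) \<noteq> 0\<close> T_pos in auto)
  then show ?thesis by eventually_elim auto
next
  case False
  have "isCont (\<lambda>w. cos (arg w)) z"
    using T_pos by (intro continuous_intros) auto
  then show ?thesis
    using False unfolding isCont_def by (rule tendsto_imp_eventually_ne)
qed

lemma F1_expanded_analytic: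
  assumes "z \<in> strip \<sigma>" "sin (arg z) \<noteq> 0"
  shows "F1_expanded analytic_on {z}"
  unfolding F1_expanded_def trig_kernel_def
  using assms by (intro analytic_intros u_analytic_at arg_analytic) auto

text \<open>At a zero of the cosine the convention for division by zero gives
  \<open>F1_formula\<close> the value 0, whereas the limit is \<open>- (T / pi) * u1\<close>. A
  limit statement therefore connects the two expressions.\<close>

lemma F1_formula_tendsto_expanded:
  assumes z: "z \<in> strip \<sigma>" "sin (arg z) \<noteq> 0"
  shows "F1_formula T t u \<midarrow>z\<rightarrow> F1_expanded z"
proof (rule Lim_transform_eventually)
  show "F1_expanded \<midarrow>z\<rightarrow> F1_expanded z"
    using analytic_at_imp_isCont[OF F1_expanded_analytic[OF z]] by (simp add: isCont_def)
  have "isCont (\<lambda>w. sin (arg w)) z"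
    using T_pos by (intro continuous_intros) auto
  then have "\<forall>\<^sub>F w in at z. sin (arg w) \<noteq> 0"
    using z(2) unfolding isCont_def by (rule tendsto_imp_eventually_ne)
  with eventually_cos_arg_nonzero[of z] show "\<forall>\<^sub>F w in at z. F1_expanded w = F1_formula T t u w"
    by eventually_elim (simp add: F1_formula_eq_expanded)
qed

lemma F1_eq_expanded: "z \<in> strip \<sigma> \<Longrightarrow> sin (arg z) \<noteq> 0 \<Longrightarrow> F1 T t u z = F1_expanded z"
  unfolding F1_def by (intro remove_sings_eqI F1_formula_tendsto_expanded)

text \<open>The value of \<open>F1\<close> at \<open>t\<close>. The u''' part is g'''(t)/6; the u'
  part comes from the constant term 1/3 in the expansion of 1/sin^2.\<close>

definition F1_center :: complex where
  "F1_center = (of_real (T / pi)) ^ 3 * u3 / 6 - of_real (T / pi) * u1 / 3"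

lemma F1_formula_tendsto_center:
  "((\<lambda>x. F1_formula T t u (of_real t + of_real x)) \<longlongrightarrow> F1_center) (at_right 0)"
proof -
  define s where "s = pi / T"
  have s: "s > 0" using T_pos by (simp add: s_def)
  have s': "T / pi = 1 / s" "T ^ 2 / (2 * pi ^ 2) = 1 / (2 * s ^ 2)"
    using T_pos by (auto simp: s_def power_divide)
  define R where "R x = (u (of_real t + of_real x)
      - (\<Sum>i\<le>3. (deriv ^^ i) u (of_real t) * of_real x ^ i / fact i)) / of_real x ^ 3" for x :: real
  define L1 where "L1 x = x * (cos (s * x) / sin (s * x) ^ 3) - 1 / (s * sin (s * x) ^ 2)" for x
  define L2 where "L2 x = x ^ 2 * (cos (s * x) / sin (s * x) ^ 3) - cos (s * x) / (s ^ 2 * sin (s * x))" for x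
  define L3 where "L3 x = x ^ 3 * (cos (s * x) / sin (s * x) ^ 3)" for x
  have "(R \<longlongrightarrow> 0) (at_right 0)"
    unfolding R_def by (intro Taylor_remainder_tendsto u_analytic_at t_in_strip)
  moreover have "(L1 \<longlongrightarrow> - 1 / (3 * s)) (at_right 0)" "(L2 \<longlongrightarrow> 0) (at_right 0)" "(L3 \<longlongrightarrow> 1 / s ^ 3) (at_right 0)"
    unfolding L1_def L2_def L3_def using trig_limits[OF s] by blast+
  ultimately have "((\<lambda>x. u1 * of_real (L1 x) + u2 / 2 * of_real (L2 x) + (u3 / 6 + R x) * of_real (L3 x))
      \<longlongrightarrow> u1 * of_real (- 1 / (3 * s)) + u2 / 2 * of_real 0 + (u3 / 6 + 0) * of_real (1 / s ^ 3)) (at_right 0)"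
    by (intro tendsto_intros)
  also have "u1 * of_real (- 1 / (3 * s)) + u2 / 2 * of_real 0 + (u3 / 6 + 0) * of_real (1 / s ^ 3) = F1_center"
    unfolding F1_center_def s' by (simp add: power_divide mult.commute)
  finally show ?thesis
  proof (rule Lim_transform_eventually)
    \<comment> \<open>The bound is T/2: up to there neither sine nor cosine vanishes, so
      \<open>F1_formula\<close> may be replaced by \<open>F1_expanded\<close>.\<close>
    have "0 < pi / (2 * s)" using s by simp
    from eventually_at_right_real[OF this] 
    show "\<forall>\<^sub>F x in at_right 0. u1 * of_real (L1 x) + u2 / 2 * of_real (L2 x) + (u3 / 6 + R x) * of_real (L3 x)
        = F1_formula T t u (of_real t + of_real x)"
    proof eventually_elim
      case (elim x)
      then have x: "0 < s * x" "s * x < pi / 2" using s by (auto simp: field_simps)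
      have pos: "sin (s * x) > 0" "cos (s * x) > 0"
        using x by (auto intro!: sin_gt_zero cos_gt_zero)
      have arg: "arg (of_real t + of_real x) = of_real (s * x)"
        by (simp add: s_def)
      define S C where "S = complex_of_real (sin (s * x))" and "C = complex_of_real (cos (s * x))"
      define X where "X = complex_of_real x"
      define s1 where "s1 = complex_of_real s"
      have nz: "S \<noteq> 0" "C \<noteq> 0" "X \<noteq> 0" "s1 \<noteq> 0"
        using pos elim s by (auto simp: S_def C_def X_def s1_def)
      have sc: "sin (arg (of_real t + of_real x)) = S" "cos (arg (of_real t + of_real x)) = C"
        unfolding arg S_def C_def by (simp_all only: sin_of_real cos_of_real)
      have "u (of_real t + of_real x) = u0 + u1 * X + u2 / 2 * X ^ 2 + u3 / 6 * X ^ 3 + R x * X ^ 3"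
        using nz by (simp add: R_def X_def numeral_eq_Suc eval_nat_numeral)
      then have "u (of_real t + of_real x) - u0 = u1 * X + u2 / 2 * X ^ 2 + u3 / 6 * X ^ 3 + R x * X ^ 3"
        by simp
      then have "F1_expanded (of_real t + of_real x) = C / S ^ 3 * (u1 * X + u2 / 2 * X ^ 2 + u3 / 6 * X ^ 3 + R x * X ^ 3)
          - 1 / s1 * u1 / S ^ 2 - 1 / (2 * s1 ^ 2) * u2 * C / S"
        unfolding F1_expanded_def trig_kernel_def sc s' by (simp add: s1_def)
      \<comment> \<open>Regrouping by the derivatives of \<open>u\<close> pairs each divergent power
        of the kernel with the term subtracted in \<open>F1_expanded\<close>, so that every bracket
        converges by itself.\<close>
      also have "\<dots> = u1 * (X * (C / S ^ 3) - 1 / (s1 * S ^ 2))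
          + u2 / 2 * (X ^ 2 * (C / S ^ 3) - C / (s1 ^ 2 * S)) + (u3 / 6 + R x) * (X ^ 3 * (C / S ^ 3))"
      proof -
        have "K * (u1 * X + D * X ^ 2 + u3 / 6 * X ^ 3 + R x * X ^ 3) - u1 * A - D * B
            = u1 * (X * K - A) + D * (X ^ 2 * K - B) + (u3 / 6 + R x) * (X ^ 3 * K)" for K A B D
          by (simp add: algebra_simps)
        from this[of "C / S ^ 3" "u2 / 2" "1 / (s1 * S ^ 2)" "C / (s1 ^ 2 * S)"] show ?thesis
          by (simp add: mult_ac)
      qed
      also have "\<dots> = u1 * of_real (L1 x) + u2 / 2 * of_real (L2 x) + (u3 / 6 + R x) * of_real (L3 x)"
        by (simp add: L1_def L2_def L3_def S_def C_def X_def s1_def)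
      finally show ?case
        using F1_formula_eq_expanded[of "of_real t + of_real x"] nz unfolding sc by simp
    qed
  qed
qed

section \<open>Analyticity and periodicity of \<open>F1\<close>, and its value at
  \<open>t\<close>\<close>

lemma sin_arg_zeroD:
  assumes "sin (arg z) = 0"
  obtains k :: int where "z = of_real t + of_real (of_int k * T)"
proof -
  obtain k :: int where "arg z = of_real (of_int k * pi)"
    using assms sin_eq_0[of "arg z"] by blast
  moreover have "z = of_real t + arg z * (of_real T / of_real pi)"
    using T_pos by simp
  ultimately have "z = of_real t + of_real (of_int k * pi) * (of_real T / of_real pi)"
    by metis
  then show ?thesis
    using that[of k] by simp
qed

lemma F1_formula_meromorphic: "F1_formula T t u meromorphic_on strip \<sigma>"
  unfolding F1_formula_def trig_kernel_def tan_def
  by (intro meromorphic_intros analytic_on_imp_meromorphic_on u_analytic arg_analytic analytic_intros)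

lemma F1_analytic: "F1 T t u analytic_on strip \<sigma>"
  unfolding F1_def
proof (rule remove_sings_analytic_of_no_pole[OF F1_formula_meromorphic])
  fix z assume z: "z \<in> strip \<sigma>"
  show "\<not> is_pole (F1_formula T t u) z"
  proof (cases "sin (arg z) = 0")
    case False
    from F1_formula_tendsto_expanded[OF z this] show ?thesis
      unfolding is_pole_def using not_tendsto_and_filterlim_at_infinity[OF at_neq_bot] by blast
  next
    case True
    then obtain k :: int where k: "z = of_real t + of_real (of_int k * T)"
      by (rule sin_arg_zeroD)
    \<comment> \<open>Every zero of the sine is a translate of \<open>t\<close> by whole periods, so
      the one limit computed at \<open>t\<close> serves all of them.\<close>
    have "F1_formula T t u (z + of_real x) = F1_formula T t u (of_real t + of_real x)" for x
      using periodic_of_int[of \<sigma> "F1_formula T t u" T "of_real t + of_real x" k, OF F1_formula_periodic]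
        t_in_strip unfolding k strip_add_of_real by (simp add: add_ac)
    then show ?thesis
      using F1_formula_tendsto_center by (intro not_is_pole_of_real_tendsto) simp
  qed
qed

lemma F1_periodic: "z \<in> strip \<sigma> \<Longrightarrow> F1 T t u (z + of_real T) = F1 T t u z"
  unfolding F1_def by (rule remove_sings_periodic) (auto simp: F1_formula_periodic)

lemma F1_at_center: "F1 T t u (of_real t) = F1_center"
proof -
  have "isolated_singularity_at (F1_formula T t u) (of_real t)"
    using F1_formula_meromorphic t_in_strip unfolding meromorphic_on_altdef by blast
  from eventually_remove_sings_eq_at[OF this]
  have "\<forall>\<^sub>F x::real in at_right 0. F1 T t u (of_real t + of_real x) = F1_formula T t u (of_real t + of_real x)"
    unfolding F1_def by (rule eventually_compose_filterlim[OF _ filterlim_real_approach])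
  then have "((\<lambda>x. F1 T t u (of_real t + of_real x)) \<longlongrightarrow> F1_center) (at_right 0)"
    using F1_formula_tendsto_center by (subst tendsto_cong)
  moreover have "F1 T t u analytic_on {of_real t}"
    using F1_analytic t_in_strip analytic_on_subset by blast
  then have "F1 T t u \<midarrow>of_real t\<rightarrow> F1 T t u (of_real t)"
    using analytic_at_imp_isCont isContD by blast
  then have "((\<lambda>x. F1 T t u (of_real t + of_real x)) \<longlongrightarrow> F1 T t u (of_real t)) (at_right 0)"
    by (rule filterlim_compose[OF _ filterlim_real_approach])
  ultimately show ?thesis
    using tendsto_unique trivial_limit_at_right_real by blast
qed

text \<open>With \<open>y = pi * (x - t) / T\<close> the expansion y^3 cos(y)/sin(y)^3 = 1 + O(y^4)
  has no quadratic term. Hence g differs from \<open>(T / pi) ^ 3 * u\<close> by o((x - t)^3), and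
  the derivatives at \<open>t\<close> agree up to order 3.\<close>

lemma rderiv_reg_part:
  assumes "k \<le> 3"
  shows "rderiv k (reg_part t (integrand T t u)) t = of_real ((T / pi) ^ 3) * (deriv ^^ k) u (of_real t)"
proof -
  define G0 where "G0 z = (z - of_real t) ^ 3 * trig_kernel T t z * u z" for z
  define G where "G = remove_sings G0"
  define c where "c = complex_of_real ((T / pi) ^ 3)"
  have sin_arg_deriv: "((\<lambda>z. sin (arg z)) has_field_derivative of_real pi / of_real T) (at (of_real t))"
    using DERIV_chain2[OF DERIV_sin arg_has_field_derivative, of "of_real t"] by simp
  have "((\<lambda>z. (z - of_real t) / sin (arg z)) \<longlongrightarrow> of_real (T / pi)) (at (of_real t))"
    by (rule lhopital_complex_simple[OF _ sin_arg_deriv, of _ 1])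
       (use T_pos in \<open>auto intro!: derivative_eq_intros\<close>)
  moreover have "((\<lambda>z. cos (arg z) * u z) \<longlongrightarrow> 1 * u0) (at (of_real t))"
  proof -
    have "isCont (\<lambda>z. cos (arg z)) (of_real t)" "isCont u (of_real t)"
      using T_pos analytic_at_imp_isCont[OF u_analytic_at[OF t_in_strip]] by (auto intro!: continuous_intros)
    then show ?thesis
      by (intro tendsto_mult) (auto simp: isCont_def)
  qed
  ultimately have "((\<lambda>z. ((z - of_real t) / sin (arg z)) ^ 3 * (cos (arg z) * u z)) \<longlongrightarrow>
      of_real (T / pi) ^ 3 * (1 * u0)) (at (of_real t))"
    by (rule tendsto_mult[OF tendsto_power])
  then have G0_lim: "G0 \<midarrow>of_real t\<rightarrow> c * u0"
    by (simp add: G0_def[abs_def] c_def trig_kernel_def power_divide mult.assoc)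
  have "G0 meromorphic_on {of_real t}"
    unfolding G0_def trig_kernel_def
    by (intro meromorphic_intros analytic_on_imp_meromorphic_on u_analytic_at arg_analytic
        analytic_intros t_in_strip)
  then have isol: "isolated_singularity_at G0 (of_real t)"
    by (simp add: meromorphic_at_iff)
  have G_an: "G analytic_on {of_real t}"
    unfolding G_def by (rule remove_sings_analytic_at[OF isol G0_lim])
  have G_t: "G (of_real t) = c * u0"
    unfolding G_def by (rule remove_sings_eqI[OF G0_lim])
  have G_ev: "\<forall>\<^sub>F z in at (of_real t). G z = G0 z"
    unfolding G_def by (rule eventually_remove_sings_eq_at[OF isol])
  have approach: "filterlim of_real (at (of_real t :: complex)) (at t)"
    by (auto simp: filterlim_at eventually_at_filter intro!: tendsto_intros)
  have G0_real: "G0 (of_real x) = of_real ((x - t) ^ 3) * integrand T t u x" for x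
    by (simp add: G0_def integrand_def)
  have reg_t: "reg_part t (integrand T t u) t = G (of_real t)"
    using tendsto_Lim[OF _ filterlim_compose[OF G0_lim approach]]
    by (simp add: reg_part_def G_t G0_real)
  have "\<forall>\<^sub>F x in at t. G (of_real x) = G0 (of_real x)"
    using eventually_compose_filterlim[OF G_ev approach] .
  then have "\<forall>\<^sub>F x in at t. reg_part t (integrand T t u) x = G (of_real x)"
    using eventually_neq_at_within[of t] by eventually_elim (simp add: reg_part_def G0_real)
  with reg_t have "\<forall>\<^sub>F x in nhds t. reg_part t (integrand T t u) x = G (of_real x)"
    by (simp add: eventually_nhds_conv_at)
  from eventually_nhds_x_imp_x[OF eventually_rderiv_eq[OF G_an this]]
  have "rderiv k (reg_part t (integrand T t u)) t = (deriv ^^ k) G (of_real t)" .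
  \<comment> \<open>\<open>G\<close> is the analytic extension of g to a complex neighbourhood of
    \<open>t\<close>; the difference \<open>G - c * u\<close> is tested only along the real axis
    from the right.\<close>
  also have "(deriv ^^ k) (\<lambda>z. G z - c * u z) (of_real t) = 0"
  proof (rule higher_deriv_eq_0_of_real_tendsto[OF _ _ assms])
    show "(\<lambda>z. G z - c * u z) analytic_on {of_real t}"
      by (intro analytic_intros G_an u_analytic_at t_in_strip)
    define s where "s = pi / T"
    have s: "s > 0" using T_pos by (simp add: s_def)
    have c: "c = of_real (1 / s ^ 3)" by (simp add: c_def s_def power_divide)
    have "u \<midarrow>of_real t\<rightarrow> u0"
      using analytic_at_imp_isCont[OF u_analytic_at[OF t_in_strip]] by (simp add: isCont_def)
    then have "((\<lambda>x. u (of_real t + of_real x)) \<longlongrightarrow> u0) (at_right 0)"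
      by (rule filterlim_compose[OF _ filterlim_real_approach])
    then have "((\<lambda>x. of_real ((x ^ 3 * (cos (s * x) / sin (s * x) ^ 3) - 1 / s ^ 3) / x ^ 3)
        * u (of_real t + of_real x)) \<longlongrightarrow> of_real 0 * u0) (at_right 0)"
      by (intro tendsto_mult tendsto_of_real trig_limits(4) s)
    then have "((\<lambda>x. of_real ((x ^ 3 * (cos (s * x) / sin (s * x) ^ 3) - 1 / s ^ 3) / x ^ 3)
        * u (of_real t + of_real x)) \<longlongrightarrow> 0) (at_right 0)"
      by simp
    then show "((\<lambda>x. (G (of_real t + of_real x) - c * u (of_real t + of_real x)) / of_real x ^ 3)
        \<longlongrightarrow> 0) (at_right 0)"
    proof (rule Lim_transform_eventually)
      have "\<forall>\<^sub>F x::real in at_right 0. G (of_real t + of_real x) = G0 (of_real t + of_real x)"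
        using eventually_compose_filterlim[OF G_ev filterlim_real_approach] .
      then show "\<forall>\<^sub>F x in at_right 0. of_real ((x ^ 3 * (cos (s * x) / sin (s * x) ^ 3) - 1 / s ^ 3) / x ^ 3)
          * u (of_real t + of_real x) = (G (of_real t + of_real x) - c * u (of_real t + of_real x)) / of_real x ^ 3"
      proof eventually_elim
        case (elim x)
        have "trig_kernel T t (of_real t + of_real x) = of_real (cos (s * x) / sin (s * x) ^ 3)"
          using trig_kernel_of_real[of "t + x"] by (simp add: s_def)
        then show ?case
          unfolding elim G0_def c by (simp add: algebra_simps diff_divide_distrib)
      qed
    qed
  qed
  moreover have "(deriv ^^ k) (\<lambda>z. G z - c * u z) (of_real t)
      = (deriv ^^ k) G (of_real t) - c * (deriv ^^ k) u (of_real t)"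
    using higher_deriv_diff_at[OF G_an, of "\<lambda>z. c * u z" k] u_analytic_at[OF t_in_strip]
    by (simp add: higher_deriv_cmult' analytic_intros)
  ultimately show ?thesis by (simp add: c_def)
qed

end

subsection \<open>Finite part and quadrature formulas\<close>

text \<open>The \<open>GREATEST\<close> in \<open>line_max\<close> has its intended meaning only if
  the maximum is attained. Compactness of one period provides a maximiser, and periodicity makes it
  one for the whole line.\<close>

lemma norm_le_line_max:
  assumes T: "T > 0" and cont: "continuous_on (strip \<sigma>) F"
    and per: "\<And>z. z \<in> strip \<sigma> \<Longrightarrow> F (z + of_real T) = F z" and y: "\<bar>y\<bar> < \<sigma>"
  shows "norm (F (of_real x + \<i> * of_real y)) \<le> line_max F y"
proof -
  have st: "of_real x + \<i> * of_real y \<in> strip \<sigma>" for x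
    using y by (simp add: strip_def)
  have "continuous_on {0..T} (\<lambda>x. norm (F (of_real x + \<i> * of_real y)))"
    by (intro continuous_on_norm continuous_on_compose2[OF cont] continuous_intros) (use st in auto)
  from continuous_attains_sup[OF _ _ this] T
  obtain m where m: "\<forall>x\<in>{0..T}. norm (F (of_real x + \<i> * of_real y)) \<le> norm (F (of_real m + \<i> * of_real y))"
    by auto
  have all: "norm (F (of_real x + \<i> * of_real y)) \<le> norm (F (of_real m + \<i> * of_real y))" for x
  proof -
    define k where "k = \<lfloor>x / T\<rfloor>"
    have "of_int k \<le> x / T" "x / T < of_int k + 1"
      unfolding k_def by linarith+
    then have "x - of_int k * T \<in> {0..T}"
      using T by (auto simp: field_simps)
    from m[rule_format, OF this] periodic_of_int[of \<sigma> F T, OF per st[of "x - of_int k * T"], of k]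
    show ?thesis by (simp add: algebra_simps)
  qed
  have "line_max F y = norm (F (of_real m + \<i> * of_real y))"
    unfolding line_max_def by (rule Greatest_equality) (use all in auto)
  then show ?thesis using all by simp
qed

lemma sum_even_odd_split:
  fixes g :: "nat \<Rightarrow> 'a :: comm_monoid_add"
  shows "(\<Sum>j<2 * n. g j) = (\<Sum>j<n. g (2 * j)) + (\<Sum>j=1..n. g (2 * j - 1))"
  by (induction n) (auto simp: add_ac)

context periodic_strip
begin

abbreviation f where "f \<equiv> integrand T t u"

definition trapezoidal :: "nat \<Rightarrow> complex" where
  "trapezoidal n = of_real (T / real n) * (\<Sum>j<n. F1 T t u (of_real (t + real j * (T / real n))))"

text \<open>The rule takes its function as a parameter so that it can be applied both to the
  integrand and to \<open>F1\<close>; the nodes are written as \<open>t + T * c\<close> with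
  \<open>c\<close> in (0, 1).\<close>

definition midpoint :: "nat \<Rightarrow> (real \<Rightarrow> complex) \<Rightarrow> complex" where
  "midpoint n g = of_real (T / real n) * (\<Sum>j=1..n. g (t + T * ((real j - 1/2) / real n)))"

lemma integrand_eq:
  assumes "sin (pi * (x - t) / T) \<noteq> 0"
  shows "f x = F1 T t u (of_real x)
    + u0 * of_real (cos (pi * (x - t) / T) / sin (pi * (x - t) / T) ^ 3)
    + u1 * of_real (T / pi / sin (pi * (x - t) / T) ^ 2)
    + u2 * of_real (T ^ 2 / (2 * pi ^ 2) * (cos (pi * (x - t) / T) / sin (pi * (x - t) / T)))"
proof -
  have "sin (arg (of_real x)) \<noteq> 0"
    using assms unfolding arg_of_real sin_of_real by simp
  then have "F1 T t u (of_real x) = F1_expanded (of_real x)"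
    using \<sigma>_pos by (intro F1_eq_expanded) auto
  moreover define w where "w = pi * (x - t) / T"
  ultimately show ?thesis
    unfolding F1_expanded_def integrand_def trig_kernel_of_real arg_of_real sin_of_real cos_of_real w_def[symmetric]
    by (simp add: algebra_simps diff_divide_distrib)
qed

text \<open>The three singular functions have the primitives -1/(2 sin^2), -cot and ln|sin|, scaled
  by powers of \<open>T / pi\<close>. Writing ln|sin| as half of \<open>ln (sin ^ 2)\<close> gives
  one expression on both sides of \<open>t\<close>; this half and the factor 1/2 of u'' make the
  denominator 4.\<close>

lemma integrand_primitive:
  assumes P: "\<And>z. z \<in> strip \<sigma> \<Longrightarrow> (P has_field_derivative F1 T t u z) (at z)"
    and nz: "sin (pi * (x - t) / T) \<noteq> 0"
  shows "((\<lambda>x. P (of_real x) + u0 * of_real (- (T / (2 * pi)) * inverse (sin (pi * (x - t) / T) ^ 2))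
      + u1 * of_real (- ((T / pi) ^ 2) * cot (pi * (x - t) / T))
      + u2 * of_real ((T / pi) ^ 3 / 4 * ln (sin (pi * (x - t) / T) ^ 2))) has_vector_derivative f x) (at x)"
proof -
  define s where "s = pi / T"
  have s: "s > 0" using T_pos by (simp add: s_def)
  have w: "pi * (x - t) / T = s * (x - t)" for x by (simp add: s_def)
  have s': "T / (2 * pi) = 1 / (2 * s)" "T / pi = 1 / s" "T ^ 2 / (2 * pi ^ 2) = 1 / (2 * s ^ 2)"
    using T_pos by (auto simp: s_def power_divide)
  define S C where "S = sin (s * (x - t))" and "C = cos (s * (x - t))"
  have S: "S \<noteq> 0" using nz by (simp add: w S_def)
  have dS: "((\<lambda>x. sin (s * (x - t))) has_real_derivative C * s) (at x)"
    unfolding C_def by (rule derivative_eq_intros refl | simp)+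
  have dS2: "((\<lambda>x. sin (s * (x - t)) ^ 2) has_real_derivative 2 * S * (C * s)) (at x)"
    using DERIV_power[OF dS, of 2] by (simp add: S_def mult_ac)
  have S2: "sin (s * (x - t)) ^ 2 \<noteq> 0" using S by (simp add: S_def)
  from DERIV_cmult[OF DERIV_inverse'[OF dS2 S2], of "- (1 / (2 * s))"]
  have d1: "((\<lambda>x. - (1 / (2 * s)) * inverse (sin (s * (x - t)) ^ 2)) has_real_derivative C / S ^ 3) (at x)"
    unfolding S_def[symmetric]
    by (rule DERIV_cong) (use S s in \<open>simp add: field_simps power2_eq_square power3_eq_cube\<close>)
  have "((\<lambda>x. cot (s * (x - t))) has_real_derivative - inverse (S ^ 2) * s) (at x)"
    unfolding S_def
    by (rule DERIV_chain2[OF DERIV_cot]) (use S in \<open>auto simp: S_def intro!: derivative_eq_intros\<close>)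
  from DERIV_cmult[OF this, of "- ((1 / s) ^ 2)"]
  have d2: "((\<lambda>x. - ((1 / s) ^ 2) * cot (s * (x - t))) has_real_derivative 1 / s / S ^ 2) (at x)"
    by (rule DERIV_cong) (use s S in \<open>simp add: field_simps power2_eq_square\<close>)
  have "sin (s * (x - t)) ^ 2 > 0" using S2 by simp
  from DERIV_cmult[OF DERIV_chain2[OF DERIV_ln[OF this] dS2], of "(1 / s) ^ 3 / 4"]
  have d3: "((\<lambda>x. (1 / s) ^ 3 / 4 * ln (sin (s * (x - t)) ^ 2)) has_real_derivative 1 / (2 * s ^ 2) * (C / S)) (at x)"
    unfolding S_def[symmetric]
    by (rule DERIV_cong) (use S s in \<open>simp add: field_simps power2_eq_square power3_eq_cube\<close>)
  have "(P has_field_derivative F1 T t u (of_real x)) (at (of_real x))"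
    using \<sigma>_pos by (intro P) auto
  then have "((\<lambda>x. P (of_real x)) has_vector_derivative F1 T t u (of_real x)) (at x)"
    by (rule has_vector_derivative_real_field)
  note d = this d1[THEN has_vector_derivative_of_real] d2[THEN has_vector_derivative_of_real]
    d3[THEN has_vector_derivative_of_real]
  have "((\<lambda>x. P (of_real x) + u0 * of_real (- (1 / (2 * s)) * inverse (sin (s * (x - t)) ^ 2))
      + u1 * of_real (- ((1 / s) ^ 2) * cot (s * (x - t)))
      + u2 * of_real ((1 / s) ^ 3 / 4 * ln (sin (s * (x - t)) ^ 2))) has_vector_derivative
      F1 T t u (of_real x) + u0 * of_real (C / S ^ 3) + u1 * of_real (1 / s / S ^ 2)
      + u2 * of_real (1 / (2 * s ^ 2) * (C / S))) (at x)"
    by (intro has_vector_derivative_add has_vector_derivative_mult_right d)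
  then show ?thesis
    unfolding integrand_eq[OF nz] w s' S_def C_def .
qed

text \<open>The singular primitives are \<open>T\<close>-periodic and cancel between
  \<open>a\<close> and \<open>b\<close>, leaving \<open>C\<close>. Between
  \<open>t - \<epsilon>\<close> and \<open>t + \<epsilon>\<close> those built from
  \<open>sin ^ 2\<close> cancel because they are even, while the odd cotangent doubles; its pole in
  \<open>\<epsilon>\<close> is the subtracted 2 g'(t)/\<epsilon>.\<close>

lemma hfp_eq_period:
  assumes P: "\<And>z. z \<in> strip \<sigma> \<Longrightarrow> (P has_field_derivative F1 T t u z) (at z)"
    and C: "\<And>z. z \<in> strip \<sigma> \<Longrightarrow> P (z + of_real T) = P z + C"
    and ab: "T = b - a" "a < t" "t < b"
  shows "hfp a b t f = C"
proof -
  define s where "s = pi / T"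
  have s: "s > 0" using T_pos by (simp add: s_def)
  have s': "T / pi = 1 / s" using T_pos by (simp add: s_def)
  define \<Phi> where "\<Phi> x = P (of_real x) + u0 * of_real (- (T / (2 * pi)) * inverse (sin (pi * (x - t) / T) ^ 2))
      + u1 * of_real (- ((T / pi) ^ 2) * cot (pi * (x - t) / T))
      + u2 * of_real ((T / pi) ^ 3 / 4 * ln (sin (pi * (x - t) / T) ^ 2))" for x
  have \<Phi>: "(\<Phi> has_vector_derivative f x) (at x)" if "sin (pi * (x - t) / T) \<noteq> 0" for x
    using integrand_primitive[OF P that] by (simp add: \<Phi>_def[abs_def])
  \<comment> \<open>Within distance less than \<open>T\<close> of \<open>t\<close> the sine vanishes
    only at \<open>t\<close> itself, so the primitive is valid on each side.\<close>
  have int: "integral {c..d} f = \<Phi> d - \<Phi> c"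
    if "c \<le> d" "\<And>x. x \<in> {c..d} \<Longrightarrow> 0 < \<bar>x - t\<bar> \<and> \<bar>x - t\<bar> < T" for c d
  proof (intro integral_unique fundamental_theorem_of_calculus that(1))
    fix x assume "x \<in> {c..d}"
    with that(2) have x: "0 < \<bar>x - t\<bar>" "\<bar>x - t\<bar> < T" by auto
    then have "0 < pi * \<bar>x - t\<bar> / T" "pi * \<bar>x - t\<bar> / T < pi"
      using T_pos by (auto simp: field_simps)
    then have "sin (pi * \<bar>x - t\<bar> / T) > 0" by (rule sin_gt_zero)
    moreover have "sin (pi * \<bar>x - t\<bar> / T) \<in> {sin (pi * (x - t) / T), - sin (pi * (x - t) / T)}"
    proof (cases "t \<le> x")
      case False
      then have "pi * \<bar>x - t\<bar> / T = - (pi * (x - t) / T)"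
        using T_pos by (simp add: field_simps)
      then show ?thesis by (simp only: sin_minus) simp
    qed simp
    ultimately have "sin (pi * (x - t) / T) \<noteq> 0" by auto
    then show "(\<Phi> has_vector_derivative f x) (at x within {c..d})"
      using \<Phi> has_vector_derivative_at_within by blast
  qed
  have \<Phi>_period: "\<Phi> b - \<Phi> a = C"
  proof -
    have w: "pi * (b - t) / T = pi * (a - t) / T + pi"
      using T_pos unfolding ab(1) by (simp add: field_simps)
    have "of_real b = (of_real a + of_real T :: complex)"
      by (simp add: ab(1))
    then show ?thesis
      using C[of "of_real a"] \<sigma>_pos unfolding \<Phi>_def w cot_def by simp
  qed
  have cont: "isCont P (of_real t)"
    using P[OF t_in_strip] DERIV_isCont by blast
  have "((\<lambda>\<epsilon>. complex_of_real (t - \<epsilon>)) \<longlongrightarrow> of_real (t - 0)) (at_right 0)"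
    "((\<lambda>\<epsilon>. complex_of_real (t + \<epsilon>)) \<longlongrightarrow> of_real (t + 0)) (at_right 0)"
    by (intro tendsto_of_real tendsto_diff tendsto_add tendsto_const tendsto_ident_at)+
  with cont have lims: "((\<lambda>\<epsilon>. P (of_real (t - \<epsilon>))) \<longlongrightarrow> P (of_real t)) (at_right 0)"
      "((\<lambda>\<epsilon>. P (of_real (t + \<epsilon>))) \<longlongrightarrow> P (of_real t)) (at_right 0)"
    by (auto intro: isCont_tendsto_compose)
  have "((\<lambda>\<epsilon>. C + (P (of_real (t - \<epsilon>)) - P (of_real (t + \<epsilon>)))
      + 2 * u1 * of_real ((1 / s) * (cos (s * \<epsilon>) / sin (s * \<epsilon>) / s - 1 / (s ^ 2 * \<epsilon>))))
      \<longlongrightarrow> C + (P (of_real t) - P (of_real t)) + 2 * u1 * of_real ((1 / s) * 0)) (at_right 0)"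
    by (rule tendsto_add[OF tendsto_add[OF tendsto_const tendsto_diff[OF lims]]
        tendsto_mult[OF tendsto_const tendsto_of_real[OF tendsto_mult[OF tendsto_const trig_limits(5)[OF s]]]]])
  then have "((\<lambda>\<epsilon>. C + (P (of_real (t - \<epsilon>)) - P (of_real (t + \<epsilon>)))
      + 2 * u1 * of_real ((1 / s) * (cos (s * \<epsilon>) / sin (s * \<epsilon>) / s - 1 / (s ^ 2 * \<epsilon>)))) \<longlongrightarrow> C) (at_right 0)"
    by simp
  then have "((\<lambda>\<epsilon>::real. integral {a..t - \<epsilon>} f + integral {t + \<epsilon>..b} f
         - 2 * rderiv 1 (reg_part t f) t / of_real \<epsilon>) \<longlongrightarrow> C) (at_right 0)"
  proof (rule Lim_transform_eventually)
    have "0 < min (t - a) (b - t)" using ab by simp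
    from eventually_at_right_real[OF this]
    show "\<forall>\<^sub>F \<epsilon> in at_right 0. C + (P (of_real (t - \<epsilon>)) - P (of_real (t + \<epsilon>)))
        + 2 * u1 * of_real ((1 / s) * (cos (s * \<epsilon>) / sin (s * \<epsilon>) / s - 1 / (s ^ 2 * \<epsilon>)))
      = integral {a..t - \<epsilon>} f + integral {t + \<epsilon>..b} f
         - 2 * rderiv 1 (reg_part t f) t / of_real \<epsilon>"
    proof eventually_elim
      case (elim \<epsilon>)
      have "integral {a..t - \<epsilon>} f + integral {t + \<epsilon>..b} f
          = (\<Phi> (t - \<epsilon>) - \<Phi> a) + (\<Phi> b - \<Phi> (t + \<epsilon>))"
        using elim ab by (subst (1 2) int) auto
      also have "\<dots> = C + (\<Phi> (t - \<epsilon>) - \<Phi> (t + \<epsilon>))"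
        using \<Phi>_period by (simp add: algebra_simps)
      also have "\<Phi> (t - \<epsilon>) - \<Phi> (t + \<epsilon>) = P (of_real (t - \<epsilon>)) - P (of_real (t + \<epsilon>))
          + 2 * u1 * of_real ((1 / s) ^ 2 * cot (s * \<epsilon>))"
      proof -
        have w: "pi * (t - \<epsilon> - t) / T = - (s * \<epsilon>)" "pi * (t + \<epsilon> - t) / T = s * \<epsilon>"
          by (simp_all add: s_def)
        show ?thesis
          unfolding \<Phi>_def w s' by (simp add: algebra_simps)
      qed
      finally have int_eq: "integral {a..t - \<epsilon>} f + integral {t + \<epsilon>..b} f
          = C + (P (of_real (t - \<epsilon>)) - P (of_real (t + \<epsilon>)) + 2 * u1 * of_real ((1 / s) ^ 2 * cot (s * \<epsilon>)))" .
      have r: "rderiv 1 (reg_part t f) t = of_real ((1 / s) ^ 3) * u1"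
        using rderiv_reg_part[of 1] by (simp add: s')
      have "(1 / s) * (cos (s * \<epsilon>) / sin (s * \<epsilon>) / s - 1 / (s ^ 2 * \<epsilon>))
          = (1 / s) ^ 2 * cot (s * \<epsilon>) - (1 / s) ^ 3 / \<epsilon>"
        by (simp add: cot_def right_diff_distrib power2_eq_square power3_eq_cube mult_ac)
      then show ?case
        unfolding int_eq r by (simp only: of_real_diff) (simp add: algebra_simps)
    qed
  qed
  then show ?thesis
    unfolding hfp_def by (intro tendsto_Lim) auto
qed

section \<open>Reduction of the quadrature formulas to trapezoidal sums of \<open>F1\<close>\<close>

lemma sum_integrand_symmetric_nodes:
  assumes c: "\<And>j. j \<in> {1..m} \<Longrightarrow> 0 < c j \<and> c j < 1"
    and sym: "\<And>j. j \<in> {1..m} \<Longrightarrow> c (Suc m - j) = 1 - c j"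
  shows "(\<Sum>j=1..m. f (t + T * c j)) =
    (\<Sum>j=1..m. F1 T t u (of_real (t + T * c j))) + u1 * of_real (T / pi * (\<Sum>j=1..m. 1 / sin (pi * c j) ^ 2))"
proof -
  have w: "pi * (t + T * c j - t) / T = pi * c j" for j
    using T_pos by simp
  have nz: "sin (pi * c j) \<noteq> 0" if "j \<in> {1..m}" for j
  proof -
    have "0 < pi * c j" "pi * c j < pi * 1"
      using c[OF that] by (auto intro: mult_strict_left_mono)
    then show ?thesis using sin_gt_zero[of "pi * c j"] by simp
  qed
  \<comment> \<open>Reflection of the nodes about \<open>t + T / 2\<close> preserves the sine and
    negates the cosine, so the sums of cos/sin^3 and cos/sin cancel in pairs.\<close>
  have mirror: "sin (pi * c (Suc m - j)) = sin (pi * c j)" "cos (pi * c (Suc m - j)) = - cos (pi * c j)"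
    if "j \<in> {1..m}" for j
    unfolding sym[OF that] by (simp_all add: algebra_simps cos_diff sin_diff)
  have "(\<Sum>j=1..m. f (t + T * c j)) = (\<Sum>j=1..m. F1 T t u (of_real (t + T * c j))
      + u0 * of_real (cos (pi * c j) / sin (pi * c j) ^ 3)
      + u1 * of_real (T / pi / sin (pi * c j) ^ 2)
      + u2 * of_real (T ^ 2 / (2 * pi ^ 2) * (cos (pi * c j) / sin (pi * c j))))"
    by (intro sum.cong refl, subst integrand_eq, unfold w) (use nz in auto)
  also have "\<dots> = (\<Sum>j=1..m. F1 T t u (of_real (t + T * c j)))
      + u0 * of_real (\<Sum>j=1..m. cos (pi * c j) / sin (pi * c j) ^ 3)
      + u1 * of_real (\<Sum>j=1..m. T / pi / sin (pi * c j) ^ 2)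
      + u2 * of_real (\<Sum>j=1..m. T ^ 2 / (2 * pi ^ 2) * (cos (pi * c j) / sin (pi * c j)))"
    by (simp only: sum.distrib sum_distrib_left of_real_sum)
  also have "(\<Sum>j=1..m. cos (pi * c j) / sin (pi * c j) ^ 3) = 0"
    by (rule sum_antisymmetric_eq_0) (simp add: mirror)
  also have "(\<Sum>j=1..m. T ^ 2 / (2 * pi ^ 2) * (cos (pi * c j) / sin (pi * c j))) = 0"
    by (rule sum_antisymmetric_eq_0) (simp add: mirror)
  also have "(\<Sum>j=1..m. T / pi / sin (pi * c j) ^ 2) = T / pi * (\<Sum>j=1..m. 1 / sin (pi * c j) ^ 2)"
    by (simp add: sum_distrib_left)
  finally show ?thesis by simp
qed

lemma quad0_eq_trapezoidal:
  assumes n: "n > 0"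
  shows "quad0 T t n f = trapezoidal n"
proof -
  define h where "h = T / real n"
  have h: "real j * h = T * (real j / real n)" for j by (simp add: h_def)
  have "(\<Sum>j=1..n-1. f (t + real j * h)) = (\<Sum>j=1..n-1. F1 T t u (of_real (t + real j * h)))
      + u1 * of_real (T / pi * (\<Sum>j=1..n-1. 1 / sin (pi * (real j / real n)) ^ 2))"
    unfolding h using n by (intro sum_integrand_symmetric_nodes) (auto simp: of_nat_diff field_simps)
  also have "(\<Sum>j=1..n-1. 1 / sin (pi * (real j / real n)) ^ 2) = ((real n) ^ 2 - 1) / 3"
    using sum_csc_squared_nodes[OF n] by simp
  finally have sum: "(\<Sum>j=1..n-1. f (t + real j * h)) = (\<Sum>j=1..n-1. F1 T t u (of_real (t + real j * h)))
      + u1 * of_real (T / pi * (((real n) ^ 2 - 1) / 3))" .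
  have "{..<n} = insert 0 {1..n-1}" using n by auto
  then have trap: "trapezoidal n = of_real h * (F1_center + (\<Sum>j=1..n-1. F1 T t u (of_real (t + real j * h))))"
    by (simp add: trapezoidal_def h_def F1_at_center)
  have r: "rderiv 1 (reg_part t f) t = of_real ((T / pi) ^ 3) * u1"
    "rderiv 3 (reg_part t f) t = of_real ((T / pi) ^ 3) * u3"
    using rderiv_reg_part[of 1] rderiv_reg_part[of 3] by simp_all
  have "quad0 T t n f = of_real h * (\<Sum>j=1..n-1. F1 T t u (of_real (t + real j * h)))
      + u1 * of_real (h * (T / pi * (((real n) ^ 2 - 1) / 3)) - pi ^ 2 / 3 * (T / pi) ^ 3 * inverse h)
      + u3 * of_real ((T / pi) ^ 3 / 6 * h)"
    unfolding quad0_def Let_def h_def[symmetric] sum r by (simp add: algebra_simps)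
  \<comment> \<open>The correction in \<open>1 / h\<close> removes only the \<open>n^2\<close> part
    of the sum of squared cosecants. The rest, together with the g''' term, is
    \<open>h * F1_center\<close>, the contribution of the omitted node \<open>t\<close>.\<close>
  also have "h * (T / pi * (((real n) ^ 2 - 1) / 3)) - pi ^ 2 / 3 * (T / pi) ^ 3 * inverse h = - (h * (T / pi) / 3)"
    using T_pos n by (simp add: h_def field_simps power2_eq_square power3_eq_cube)
  finally show ?thesis
    unfolding trap F1_center_def by (simp add: algebra_simps)
qed

lemma midpoint_integrand:
  assumes n: "n > 0"
  shows "midpoint n f = midpoint n (\<lambda>x. F1 T t u (of_real x)) + u1 * of_real (T ^ 2 * real n / pi)"
proof -
  have "(\<Sum>j=1..n. f (t + T * ((real j - 1/2) / real n))) = (\<Sum>j=1..n. F1 T t u (of_real (t + T * ((real j - 1/2) / real n))))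
      + u1 * of_real (T / pi * (\<Sum>j=1..n. 1 / sin (pi * ((real j - 1/2) / real n)) ^ 2))"
    using n by (intro sum_integrand_symmetric_nodes) (auto simp: of_nat_diff field_simps)
  also have "(\<Sum>j=1..n. 1 / sin (pi * ((real j - 1/2) / real n)) ^ 2) = (real n) ^ 2"
    using sum_csc_squared_midpoints[OF n] by simp
  finally show ?thesis
    using n by (simp add: midpoint_def field_simps power2_eq_square)
qed

text \<open>Among the nodes of the rule with \<open>2 * n\<close> points the even ones form the rule
  with \<open>n\<close> points and the odd ones are the midpoints.\<close>

lemma midpoint_eq_trapezoidal:
  assumes n: "n > 0"
  shows "midpoint n (\<lambda>x. F1 T t u (of_real x)) = 2 * trapezoidal (2 * n) - trapezoidal n"
proof -
  define G where "G x = F1 T t u (of_real (t + x))" for x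
  have "(\<Sum>j=1..n. G (T * ((real j - 1/2) / real n))) = (\<Sum>j=1..n. G (real (2 * j - 1) * (T / real (2 * n))))"
    by (intro sum.cong refl arg_cong[of _ _ G]) (use n in \<open>auto simp: of_nat_diff field_simps\<close>)
  moreover have "(\<Sum>j<n. G (real (2 * j) * (T / real (2 * n)))) = (\<Sum>j<n. G (real j * (T / real n)))"
    by (intro sum.cong refl arg_cong[of _ _ G]) auto
  ultimately have "(\<Sum>j<2 * n. G (real j * (T / real (2 * n))))
      = (\<Sum>j<n. G (real j * (T / real n))) + (\<Sum>j=1..n. G (T * ((real j - 1/2) / real n)))"
    using sum_even_odd_split[of "\<lambda>j. G (real j * (T / real (2 * n)))" n] by simp
  then show ?thesis
    using n unfolding midpoint_def trapezoidal_def G_def[symmetric] by (simp add: field_simps)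
qed

lemma quad1_eq_trapezoidal:
  assumes n: "n > 0"
  shows "quad1 T t n f = 2 * trapezoidal (2 * n) - trapezoidal n"
proof -
  have node: "t + real j * (T / real n) - T / real n / 2 = t + T * ((real j - 1/2) / real n)" for j
    using n by (simp add: field_simps)
  have "rderiv 1 (reg_part t f) t = of_real ((T / pi) ^ 3) * u1"
    using rderiv_reg_part[of 1] by simp
  then have "quad1 T t n f = midpoint n f - u1 * of_real (pi ^ 2 * (T / pi) ^ 3 * inverse (T / real n))"
    unfolding quad1_def Let_def node midpoint_def by (simp add: algebra_simps)
  also have "pi ^ 2 * (T / pi) ^ 3 * inverse (T / real n) = T ^ 2 * real n / pi"
    using T_pos by (simp add: field_simps power2_eq_square power3_eq_cube)
  finally show ?thesis
    by (simp add: midpoint_integrand[OF n] midpoint_eq_trapezoidal[OF n])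
qed

text \<open>The u' contribution to the midpoint sum is proportional to \<open>n\<close>, so it
  cancels in twice the sum for \<open>n\<close> minus the sum for \<open>2 * n\<close>. This
  explains why the formula contains no derivative of g.\<close>

lemma quad2_eq_trapezoidal:
  assumes n: "n > 0"
  shows "quad2 T t n f = 5 * trapezoidal (2 * n) - 2 * trapezoidal n - 2 * trapezoidal (4 * n)"
proof -
  have node: "t + real j * (T / real n) - T / real n / 2 = t + T * ((real j - 1/2) / real n)"
    "t + real j * (T / real n) / 2 - T / real n / 4 = t + T * ((real j - 1/2) / real (2 * n))" for j
    using n by (simp_all add: field_simps)
  have "quad2 T t n f = 2 * midpoint n f - midpoint (2 * n) f"
    unfolding quad2_def Let_def node midpoint_def by (simp add: mult.assoc)
  also have "\<dots> = 2 * (2 * trapezoidal (2 * n) - trapezoidal n) - (2 * trapezoidal (2 * (2 * n)) - trapezoidal (2 * n))"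
    using n by (subst (1 2) midpoint_integrand; simp add: midpoint_eq_trapezoidal)
  finally show ?thesis by simp
qed

end

theorem theorem5p2:
  fixes a b T t \<sigma> :: real and u :: "complex \<Rightarrow> complex"
  assumes "a < b" and "T = b - a" and "t \<in> {a<..<b}" and "\<sigma> > 0"
    and "u analytic_on strip \<sigma>"
    and "\<And>z. z \<in> strip \<sigma> \<Longrightarrow> u (z + of_real T) = u z"
  shows "(\<forall>z \<in> strip \<sigma>. F1 T t u (z + of_real T) = F1 T t u z)
    \<and> F1 T t u analytic_on strip \<sigma>
    \<and> (\<forall>\<tau> \<in> {0<..<\<sigma>}. \<forall>n::nat. n > 0 \<longrightarrow>
         norm (err0 a b t n (integrand T t u)) \<le> T * M_bound T t u \<tau> * phi T n \<tau>
       \<and> norm (err1 a b t n (integrand T t u))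
           \<le> T * M_bound T t u \<tau> * (phi T n \<tau> + 2 * phi T (2 * n) \<tau>)
       \<and> norm (err2 a b t n (integrand T t u))
           \<le> T * M_bound T t u \<tau> * (2 * phi T n \<tau> + 5 * phi T (2 * n) \<tau> + 2 * phi T (4 * n) \<tau>))"
proof -
  interpret periodic_strip T t \<sigma> u
    using assms by unfold_locales auto
  have holo: "F1 T t u holomorphic_on strip \<sigma>"
    using F1_analytic analytic_imp_holomorphic by blast
  obtain P C where P: "\<And>z. z \<in> strip \<sigma> \<Longrightarrow> (P has_field_derivative F1 T t u z) (at z)"
    and C: "\<And>z. z \<in> strip \<sigma> \<Longrightarrow> P (z + of_real T) = P z + C"
    using periodic_primitive[OF holo F1_periodic] by blast
  have hfp: "hfp a b t f = C"
    using hfp_eq_period[OF P C] assms by simp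
  show ?thesis
  proof (intro conjI ballI allI impI)
    fix \<tau> and n :: nat
    assume \<tau>: "\<tau> \<in> {0<..<\<sigma>}" and n: "n > 0"
    define B where "B m = T * M_bound T t u \<tau> * phi T m \<tau>" for m
    have cont: "continuous_on (strip \<sigma>) (F1 T t u)"
      using holo by (rule holomorphic_on_imp_continuous_on)
    have max: "norm (F1 T t u (of_real x + \<i> * of_real y)) \<le> line_max (F1 T t u) y" if "\<bar>y\<bar> < \<sigma>" for x y
      by (rule norm_le_line_max[OF T_pos cont F1_periodic that])
    have E: "norm (trapezoidal m - C) \<le> B m" if "m > 0" for m
      unfolding trapezoidal_def M_bound_def B_def
      by (rule trapezoidal_rule_error[OF T_pos _ _ that holo F1_periodic P C max max])
         (use \<tau> in auto)
    note E = E[of n] E[of "2 * n"] E[of "4 * n"]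
    have "err0 a b t n f = trapezoidal n - C"
      using quad0_eq_trapezoidal[OF n] by (simp add: err0_def hfp flip: assms(2))
    then show "norm (err0 a b t n f) \<le> T * M_bound T t u \<tau> * phi T n \<tau>"
      using E n by (simp add: B_def)
    \<comment> \<open>The coefficients 2, -1 here, and 5, -2, -2 for the last formula, add up to 1,
      so the same combination holds between the errors.\<close>
    have "err1 a b t n f = 2 * (trapezoidal (2 * n) - C) - (trapezoidal n - C)"
      using quad1_eq_trapezoidal[OF n] by (simp add: err1_def hfp algebra_simps flip: assms(2))
    then have "norm (err1 a b t n f) \<le> 2 * norm (trapezoidal (2 * n) - C) + norm (trapezoidal n - C)"
      by (metis norm_mult norm_numeral norm_triangle_ineq4)
    also have "\<dots> \<le> 2 * B (2 * n) + B n"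
      using E n by simp
    finally show "norm (err1 a b t n f) \<le> T * M_bound T t u \<tau> * (phi T n \<tau> + 2 * phi T (2 * n) \<tau>)"
      by (simp add: B_def algebra_simps)
    have "err2 a b t n f = 5 * (trapezoidal (2 * n) - C) - 2 * (trapezoidal n - C) - 2 * (trapezoidal (4 * n) - C)"
      using quad2_eq_trapezoidal[OF n] by (simp add: err2_def hfp algebra_simps flip: assms(2))
    then have "norm (err2 a b t n f) \<le> 5 * norm (trapezoidal (2 * n) - C) + 2 * norm (trapezoidal n - C)
        + 2 * norm (trapezoidal (4 * n) - C)"
      using norm_triangle_ineq4[of "5 * (trapezoidal (2 * n) - C) - 2 * (trapezoidal n - C)" "2 * (trapezoidal (4 * n) - C)"]
        norm_triangle_ineq4[of "5 * (trapezoidal (2 * n) - C)" "2 * (trapezoidal n - C)"]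
      unfolding norm_mult norm_numeral by simp
    also have "\<dots> \<le> 5 * B (2 * n) + 2 * B n + 2 * B (4 * n)"
      using E n by simp
    finally show "norm (err2 a b t n f)
        \<le> T * M_bound T t u \<tau> * (2 * phi T n \<tau> + 5 * phi T (2 * n) \<tau> + 2 * phi T (4 * n) \<tau>)"
      by (simp add: B_def algebra_simps)
  qed (use F1_periodic F1_analytic in auto)
qed

end
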